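(* Let $G$ be a connected graph and let $U \subseteq V(G)$. Then $U$ is normally spanned in $G$ if and only if every $U$-rooted minor of $G$ has countable colouring number.
   Context: A rooted tree $T \subseteq G$ (with tree order $x \le y$ iff $x$ lies on the path in $T$ from the root to $y$) is normal in $G$ if for every $T$-path $P$ in $G$ (a path with at least one edge whose two endvertices lie in $T$ and whose edges and inner vertices lie outside $T$) the endvertices of $P$ are comparable in the tree order. A set $U \subseteq V(G)$ is normally spanned in $G$ if there is a normal tree $T$ in $G$ with $U \subseteq V(T)$. A minor $H$ of $G$ is given by disjoint connected branch sets $X_v \subseteq V(G)$ ($v \in V(H)$), with $vw \in E(H)$ only if there is an edge of $G$ between $X_v$ and $X_w$; it is $U$-rooted if every branch set contains a vertex of $U$. A graph has countable colouring number if its vertex set admits a well-order in which every vertex is preceded by only finitely many of its neighbours. *)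

theory Defs
  imports Main
begin

definition graph :: "'a set \<Rightarrow> ('a \<Rightarrow> 'a \<Rightarrow> bool) \<Rightarrow> bool" where
  "graph V E \<longleftrightarrow> (\<forall>x y. E x y \<longrightarrow> x \<in> V \<and> y \<in> V) \<and> (\<forall>x y. E x y \<longrightarrow> E y x) \<and> (\<forall>x. \<not> E x x)"

definition is_path :: "('a \<Rightarrow> 'a \<Rightarrow> bool) \<Rightarrow> 'a list \<Rightarrow> bool" where
  "is_path E ps \<longleftrightarrow> ps \<noteq> [] \<and> distinct ps \<and> (\<forall>i. Suc i < length ps \<longrightarrow> E (ps ! i) (ps ! Suc i))"

definition connected_graph :: "'a set \<Rightarrow> ('a \<Rightarrow> 'a \<Rightarrow> bool) \<Rightarrow> bool" where
  "connected_graph V E \<longleftrightarrow> V \<noteq> {} \<and>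
     (\<forall>x\<in>V. \<forall>y\<in>V. \<exists>ps. is_path E ps \<and> hd ps = x \<and> last ps = y)"

definition connected_set :: "'a set \<Rightarrow> ('a \<Rightarrow> 'a \<Rightarrow> bool) \<Rightarrow> 'a set \<Rightarrow> bool" where
  "connected_set V E X \<longleftrightarrow> X \<noteq> {} \<and> X \<subseteq> V \<and>
     (\<forall>x\<in>X. \<forall>y\<in>X. \<exists>ps. is_path E ps \<and> set ps \<subseteq> X \<and> hd ps = x \<and> last ps = y)"

definition has_cycle :: "('a \<Rightarrow> 'a \<Rightarrow> bool) \<Rightarrow> bool" where
  "has_cycle E \<longleftrightarrow> (\<exists>ps. is_path E ps \<and> 3 \<le> length ps \<and> E (last ps) (hd ps))"

definition is_tree :: "'a set \<Rightarrow> ('a \<Rightarrow> 'a \<Rightarrow> bool) \<Rightarrow> bool" where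
  "is_tree VT ET \<longleftrightarrow> graph VT ET \<and> connected_graph VT ET \<and> \<not> has_cycle ET"

definition subgraph :: "'a set \<Rightarrow> ('a \<Rightarrow> 'a \<Rightarrow> bool) \<Rightarrow> 'a set \<Rightarrow> ('a \<Rightarrow> 'a \<Rightarrow> bool) \<Rightarrow> bool" where
  "subgraph VT ET V E \<longleftrightarrow> VT \<subseteq> V \<and> (\<forall>x y. ET x y \<longrightarrow> E x y)"

definition tree_le :: "('a \<Rightarrow> 'a \<Rightarrow> bool) \<Rightarrow> 'a \<Rightarrow> 'a \<Rightarrow> 'a \<Rightarrow> bool" where
  "tree_le ET r x y \<longleftrightarrow> (\<exists>ps. is_path ET ps \<and> hd ps = r \<and> last ps = y \<and> x \<in> set ps)"

definition T_path :: "'a set \<Rightarrow> ('a \<Rightarrow> 'a \<Rightarrow> bool) \<Rightarrow> ('a \<Rightarrow> 'a \<Rightarrow> bool) \<Rightarrow> 'a list \<Rightarrow> bool" where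
  "T_path VT ET E ps \<longleftrightarrow> is_path E ps \<and> 2 \<le> length ps \<and> hd ps \<in> VT \<and> last ps \<in> VT \<and>
     (\<forall>i. Suc i < length ps \<longrightarrow> \<not> ET (ps ! i) (ps ! Suc i)) \<and>
     (\<forall>i. 0 < i \<and> i < length ps - 1 \<longrightarrow> ps ! i \<notin> VT)"

definition normal_tree :: "'a set \<Rightarrow> ('a \<Rightarrow> 'a \<Rightarrow> bool) \<Rightarrow> 'a set \<Rightarrow> ('a \<Rightarrow> 'a \<Rightarrow> bool) \<Rightarrow> 'a \<Rightarrow> bool" where
  "normal_tree V E VT ET r \<longleftrightarrow> subgraph VT ET V E \<and> is_tree VT ET \<and> r \<in> VT \<and>
     (\<forall>ps. T_path VT ET E ps \<longrightarrow> tree_le ET r (hd ps) (last ps) \<or> tree_le ET r (last ps) (hd ps))"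

definition normally_spanned :: "'a set \<Rightarrow> ('a \<Rightarrow> 'a \<Rightarrow> bool) \<Rightarrow> 'a set \<Rightarrow> bool" where
  "normally_spanned V E U \<longleftrightarrow> (\<exists>VT ET r. normal_tree V E VT ET r \<and> U \<subseteq> VT)"

text \<open>A minor H of G, with the branch sets themselves as the vertices of H.\<close>
definition is_minor :: "'a set \<Rightarrow> ('a \<Rightarrow> 'a \<Rightarrow> bool) \<Rightarrow> 'a set set \<Rightarrow> ('a set \<Rightarrow> 'a set \<Rightarrow> bool) \<Rightarrow> bool" where
  "is_minor V E VH EH \<longleftrightarrow> graph VH EH \<and> (\<forall>X\<in>VH. connected_set V E X) \<and>
     (\<forall>X\<in>VH. \<forall>Y\<in>VH. X \<noteq> Y \<longrightarrow> X \<inter> Y = {}) \<and>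
     (\<forall>X Y. EH X Y \<longrightarrow> (\<exists>x\<in>X. \<exists>y\<in>Y. E x y))"

definition rooted_minor :: "'a set \<Rightarrow> 'a set set \<Rightarrow> bool" where
  "rooted_minor U VH \<longleftrightarrow> (\<forall>X\<in>VH. X \<inter> U \<noteq> {})"

definition countable_colouring_number :: "'b set \<Rightarrow> ('b \<Rightarrow> 'b \<Rightarrow> bool) \<Rightarrow> bool" where
  "countable_colouring_number V E \<longleftrightarrow> (\<exists>R. Well_order R \<and> Field R = V \<and>
     (\<forall>v\<in>V. finite {w. E v w \<and> (w, v) \<in> R \<and> w \<noteq> v}))"

end

theory Submission
  imports Defs "HOL-Library.Countable_Set"
begin

text \<open>
  If \<open>T\<close> is a normal tree containing \<open>U\<close>, then every connected set that meets \<open>T\<close> has a least vertex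
  in the tree order, and adjacent branch sets of a \<open>U\<close>-rooted minor have comparable least vertices.
  Ordering the branch sets by the height of these vertices leaves each of them with only finitely
  many preceding neighbours, because down-closures in \<open>T\<close> are finite.

  Conversely, call a connected set rooted if it meets \<open>U\<close>. It suffices to find countable sets \<open>F x\<close>
  such that every rooted connected set disjoint from an \<open>F\<close>-closed set \<open>Z\<close> has only finitely many
  neighbours in \<open>Z\<close>: a normal tree that is closed under \<open>F\<close> as far as the rooted components of its
  complement are concerned can then be extended by countably many vertices to a larger one, since
  the finitely many neighbours of such a component form a chain and the component can be entered
  from the top of this chain. Zorn's lemma gives a normal tree containing \<open>U\<close>.

  To obtain \<open>F\<close>, exhaust the graph transfinitely, removing from every rooted component \<open>K\<close> of the
  remainder a countable set \<open>hit K\<close> composed of rooted connected pieces which meets every rooted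
  connected subset of \<open>K\<close> that has infinitely many neighbours outside \<open>K\<close>. Here \<open>hit K\<close> can be taken
  countable because uncountably many disjoint rooted connected sets, each with infinitely many
  neighbours in a fixed countable set, yield a rooted minor of uncountable colouring number. All
  boundaries stay countable in the process, also at limits. Contracting the pieces of all sets \<open>hit K\<close>
  gives one single rooted minor. The closure \<open>F\<close> takes into account the countable data attached to
  the layer of a vertex together with the finitely many preceding neighbours of its piece in a good
  well-order of this minor; a rooted connected set with infinitely many neighbours in an \<open>F\<close>-closed
  set would meet a piece with infinitely many preceding neighbours. No induction on cardinalities
  is needed.
\<close>

section \<open>Connected sets and components\<close>

definition edges_in :: "('a \<Rightarrow> 'a \<Rightarrow> bool) \<Rightarrow> 'a set \<Rightarrow> ('a \<times> 'a) set" where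
  "edges_in E W = {(x, y). E x y \<and> x \<in> W \<and> y \<in> W}"

definition conn :: "('a \<Rightarrow> 'a \<Rightarrow> bool) \<Rightarrow> 'a set \<Rightarrow> bool" where
  "conn E C \<longleftrightarrow> (\<forall>x\<in>C. \<forall>y\<in>C. (x, y) \<in> (edges_in E C)\<^sup>*)"

text \<open>For \<open>x\<close> outside \<open>W\<close> no edge of \<open>edges_in E W\<close>
  starts in \<open>x\<close>, so the value is \<open>{x}\<close>; containment in \<open>W\<close>
  therefore needs \<open>x \<in> W\<close>.\<close>

definition component :: "('a \<Rightarrow> 'a \<Rightarrow> bool) \<Rightarrow> 'a set \<Rightarrow> 'a \<Rightarrow> 'a set" where
  "component E W x = {y. (x, y) \<in> (edges_in E W)\<^sup>*}"

definition nb :: "('a \<Rightarrow> 'a \<Rightarrow> bool) \<Rightarrow> 'a set \<Rightarrow> 'a set \<Rightarrow> 'a set" where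
  "nb E S C = {y \<in> S. \<exists>c\<in>C. E c y}"

abbreviation bd :: "('a \<Rightarrow> 'a \<Rightarrow> bool) \<Rightarrow> 'a set \<Rightarrow> 'a set" where
  "bd E K \<equiv> nb E (- K) K"

lemma edges_in_mono: "A \<subseteq> B \<Longrightarrow> edges_in E A \<subseteq> edges_in E B"
  by (auto simp: edges_in_def)

lemma edges_in_rtrancl_mono: "(x, y) \<in> (edges_in E A)\<^sup>* \<Longrightarrow> A \<subseteq> B \<Longrightarrow> (x, y) \<in> (edges_in E B)\<^sup>*"
  using rtrancl_mono[OF edges_in_mono] by blast

lemma edges_in_rtrancl_sym:
  assumes "symp E" "(x, y) \<in> (edges_in E A)\<^sup>*"
  shows "(y, x) \<in> (edges_in E A)\<^sup>*"
proof -
  have "sym (edges_in E A)"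
    using assms(1) by (auto simp: sym_def symp_def edges_in_def)
  then show ?thesis
    using assms(2) by (meson sym_rtrancl symD)
qed

lemma edges_in_rtrancl_mem: "(x, y) \<in> (edges_in E A)\<^sup>* \<Longrightarrow> x \<in> A \<Longrightarrow> y \<in> A"
  by (induction rule: rtrancl_induct) (auto simp: edges_in_def)

lemma component_self [simp]: "x \<in> component E W x"
  by (simp add: component_def)

lemma component_subset: "x \<in> W \<Longrightarrow> component E W x \<subseteq> W"
  by (auto simp: component_def dest: edges_in_rtrancl_mem)

lemma component_eq:
  assumes "symp E" "y \<in> component E W x"
  shows "component E W y = component E W x"
proof -
  have "(x, y) \<in> (edges_in E W)\<^sup>*" "(y, x) \<in> (edges_in E W)\<^sup>*"
    using assms edges_in_rtrancl_sym by (auto simp: component_def)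
  then show ?thesis
    by (auto simp: component_def intro: rtrancl_trans)
qed

lemma component_edges_in_rtrancl:
  assumes "(x, y) \<in> (edges_in E W)\<^sup>*"
  shows "(x, y) \<in> (edges_in E (component E W x))\<^sup>*"
  using assms
proof (induction rule: rtrancl_induct)
  case (step y z)
  have "(y, z) \<in> edges_in E (component E W x)"
    using step.hyps by (auto simp: component_def edges_in_def intro: rtrancl.rtrancl_into_rtrancl)
  then show ?case
    using step.IH by simp
qed simp

lemma conn_component:
  assumes "symp E"
  shows "conn E (component E W x)"
  unfolding conn_def
proof (intro ballI)
  fix y z assume "y \<in> component E W x" "z \<in> component E W x"
  then have "z \<in> component E W y" "component E W y = component E W x"
    using component_eq[OF assms] by auto
  then show "(y, z) \<in> (edges_in E (component E W x))\<^sup>*"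
    using component_edges_in_rtrancl[of y z E W] by (auto simp: component_def)
qed

lemma conn_subset_component:
  assumes "symp E" "conn E C" "C \<subseteq> W" "C \<inter> component E W x \<noteq> {}"
  shows "C \<subseteq> component E W x"
proof
  fix z assume z: "z \<in> C"
  obtain y where y: "y \<in> C" "y \<in> component E W x"
    using assms(4) by blast
  have "(y, z) \<in> (edges_in E W)\<^sup>*"
    using assms(2,3) y z edges_in_rtrancl_mono[of y z E C W] by (auto simp: conn_def)
  then show "z \<in> component E W x"
    using y by (auto simp: component_def)
qed

lemma conn_singleton [simp]: "conn E {x}"
  by (simp add: conn_def)

lemma conn_Un:
  assumes sym: "symp E" and A: "conn E A" and B: "conn E B" and ab: "a \<in> A" "b \<in> B" "a = b \<or> E a b"
  shows "conn E (A \<union> B)"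
proof -
  let ?R = "(edges_in E (A \<union> B))\<^sup>*"
  have 1: "(x, a) \<in> ?R \<and> (a, x) \<in> ?R" if "x \<in> A" for x
    using A that ab(1) by (auto simp: conn_def intro: edges_in_rtrancl_mono[of _ _ E A])
  have 2: "(x, b) \<in> ?R \<and> (b, x) \<in> ?R" if "x \<in> B" for x
    using B that ab(2) by (auto simp: conn_def intro: edges_in_rtrancl_mono[of _ _ E B])
  have "(a, b) \<in> ?R"
    using ab by (auto simp: edges_in_def)
  moreover have "(b, a) \<in> ?R"
    using calculation edges_in_rtrancl_sym[OF sym] by blast
  ultimately have "(a, x) \<in> ?R \<and> (x, a) \<in> ?R" if "x \<in> A \<union> B" for x
    using 1 2 that by (meson UnE rtrancl_trans)
  then show ?thesis
    unfolding conn_def by (meson rtrancl_trans)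
qed

text \<open>A walk inside \<open>C\<close> that starts in \<open>K\<close> could leave
  \<open>K\<close> only through a boundary vertex of \<open>K\<close>.\<close>

lemma conn_subset_if_avoids_bd:
  assumes "conn E C" "C \<inter> K \<noteq> {}" "C \<inter> bd E K = {}"
  shows "C \<subseteq> K"
proof
  fix z assume z: "z \<in> C"
  obtain y where y: "y \<in> C" "y \<in> K"
    using assms(2) by blast
  have "(y, z) \<in> (edges_in E C)\<^sup>*"
    using assms(1) y z by (auto simp: conn_def)
  then show "z \<in> K"
  proof (induction rule: rtrancl_induct)
    case (step u v)
    then show ?case
      using assms(3) by (auto simp: edges_in_def nb_def)
  qed (use y in simp)
qed

lemma bd_component_disjoint:
  assumes "x \<in> W"
  shows "bd E (component E W x) \<inter> W = {}"
proof -
  have "y \<in> component E W x" if "c \<in> component E W x" "E c y" "y \<in> W" for c y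
  proof -
    have "(c, y) \<in> edges_in E W"
      using that component_subset[OF assms, of E] by (auto simp: edges_in_def)
    then show ?thesis
      using that(1) by (auto simp: component_def)
  qed
  then show ?thesis
    by (auto simp: nb_def)
qed

lemma nb_mono: "S \<subseteq> S' \<Longrightarrow> C \<subseteq> C' \<Longrightarrow> nb E S C \<subseteq> nb E S' C'"
  by (auto simp: nb_def)

section \<open>Paths as lists and reachability inside a set\<close>

lemma is_path_successively: "is_path E ps \<longleftrightarrow> ps \<noteq> [] \<and> distinct ps \<and> successively E ps"
  by (simp add: is_path_def successively_conv_nth)

lemma rtrancl_edges_in_path:
  assumes "(x, y) \<in> (edges_in E A)\<^sup>*" "x \<in> A"
  shows "\<exists>ps. is_path E ps \<and> set ps \<subseteq> A \<and> hd ps = x \<and> last ps = y"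
  using assms(1)
proof (induction rule: rtrancl_induct)
  case base
  show ?case
    by (rule exI[of _ "[x]"]) (use assms(2) in \<open>auto simp: is_path_def\<close>)
next
  case (step y z)
  then obtain ps where ps: "is_path E ps" "set ps \<subseteq> A" "hd ps = x" "last ps = y"
    by blast
  show ?case
  proof (cases "z \<in> set ps")
    case True
    then obtain us vs where uv: "ps = us @ z # vs"
      by (meson split_list)
    have "is_path E (us @ [z])"
      using ps(1) unfolding is_path_successively uv
      by (auto simp: successively_append_iff)
    then show ?thesis
      using ps(2,3) uv by (intro exI[of _ "us @ [z]"]) (auto simp: hd_append)
  next
    case False
    have "E y z" "z \<in> A"
      using step.hyps by (auto simp: edges_in_def)
    then have "is_path E (ps @ [z])"
      using ps(1,4) False by (auto simp: is_path_successively successively_append_iff)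
    then show ?thesis
      using ps \<open>z \<in> A\<close> by (intro exI[of _ "ps @ [z]"]) (auto simp: is_path_def)
  qed
qed

lemma path_rtrancl_edges_in:
  assumes "successively E ps" "ps \<noteq> []" "set ps \<subseteq> A"
  shows "(hd ps, last ps) \<in> (edges_in E A)\<^sup>*"
  using assms
proof (induction ps rule: induct_list012)
  case (3 x y zs)
  then have "(x, y) \<in> edges_in E A" "(y, last (y # zs)) \<in> (edges_in E A)\<^sup>*"
    by (auto simp: edges_in_def)
  then show ?case
    by (simp add: converse_rtrancl_into_rtrancl)
qed auto

text \<open>This trades lists of vertices for reflexive transitive closures, so that connectedness
  can be handled by induction along walks.\<close>

lemma connected_set_iff_conn:
  "connected_set V E X \<longleftrightarrow> X \<noteq> {} \<and> X \<subseteq> V \<and> conn E X"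
proof -
  have "(x, y) \<in> (edges_in E X)\<^sup>* \<longleftrightarrow>
      (\<exists>ps. is_path E ps \<and> set ps \<subseteq> X \<and> hd ps = x \<and> last ps = y)" if "x \<in> X" for x y
    using that rtrancl_edges_in_path[of x y E X] path_rtrancl_edges_in[of E _ X]
    by (auto simp: is_path_successively)
  then show ?thesis
    by (auto simp: connected_set_def conn_def)
qed

lemma connected_graph_imp_conn:
  assumes "graph V E" "connected_graph V E"
  shows "conn E V"
  unfolding conn_def
proof (intro ballI)
  fix x y assume "x \<in> V" "y \<in> V"
  then obtain ps where ps: "is_path E ps" "hd ps = x" "last ps = y"
    using assms(2) by (auto simp: connected_graph_def)
  have "edges_in E UNIV = edges_in E V"
    using assms(1) by (auto simp: edges_in_def graph_def)
  then show "(x, y) \<in> (edges_in E V)\<^sup>*"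
    using path_rtrancl_edges_in[of E ps UNIV] ps by (auto simp: is_path_successively)
qed

section \<open>Rooted minors and barricades\<close>

fun pick_fresh :: "(nat \<Rightarrow> 'b set) \<Rightarrow> nat \<Rightarrow> 'b" where
  "pick_fresh S n = (SOME a. a \<in> S n \<and> (\<forall>m. m < n \<longrightarrow> a \<noteq> pick_fresh S m))"

declare pick_fresh.simps [simp del]

text \<open>Greedy choice: an infinite set always has an element outside the finitely many earlier
  picks.\<close>

lemma countable_system_of_distinct_representatives:
  assumes "countable I" and inf: "\<And>i. i \<in> I \<Longrightarrow> infinite (S i)"
  shows "\<exists>f. inj_on f I \<and> (\<forall>i\<in>I. f i \<in> S i)"
proof -
  \<comment> \<open>Numbers that code no index get some set of the family as a default, so that for
    nonempty \<open>I\<close> every \<open>S' n\<close> is infinite.\<close>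
  define S' where "S' n = (if n \<in> to_nat_on I ` I then S (from_nat_into I n) else S (SOME i. i \<in> I))" for n
  have S': "S' (to_nat_on I i) = S i" if "i \<in> I" for i
    using that assms(1) by (simp add: S'_def)
  have p: "pick_fresh S' n \<in> S' n \<and> (\<forall>m. m < n \<longrightarrow> pick_fresh S' n \<noteq> pick_fresh S' m)" if ne: "I \<noteq> {}" for n
  proof -
    obtain i where "i \<in> I"
      using ne by blast
    then have "(SOME i. i \<in> I) \<in> I"
      by (rule someI)
    then have "infinite (S' n)"
      using inf assms(1) by (auto simp: S'_def)
    then have "infinite (S' n - pick_fresh S' ` {..<n})"
      by (simp add: Diff_infinite_finite)
    then obtain a where "a \<in> S' n - pick_fresh S' ` {..<n}"
      using infinite_imp_nonempty by blast
    then have "\<exists>a. a \<in> S' n \<and> (\<forall>m. m < n \<longrightarrow> a \<noteq> pick_fresh S' m)"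
      by auto
    from someI_ex[OF this] show ?thesis
      unfolding pick_fresh.simps[of S' n, symmetric] .
  qed
  have "inj_on (\<lambda>i. pick_fresh S' (to_nat_on I i)) I"
  proof (rule inj_onI)
    fix i j assume ij: "i \<in> I" "j \<in> I" "pick_fresh S' (to_nat_on I i) = pick_fresh S' (to_nat_on I j)"
    then have "to_nat_on I i = to_nat_on I j"
      using p by (metis empty_iff nat_neq_iff)
    then show "i = j"
      using ij assms(1) by simp
  qed
  then show ?thesis
    using p S' by (metis empty_iff)
qed

locale rooted_graph =
  fixes V :: "'a set" and E :: "'a \<Rightarrow> 'a \<Rightarrow> bool" and U :: "'a set"
  assumes graph: "graph V E" and conn_V: "conn E V" and U_subset: "U \<subseteq> V"
begin

lemma symp_E: "symp E"
  using graph by (auto simp: graph_def symp_def)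

lemma E_sym: "E x y \<Longrightarrow> E y x"
  using graph by (auto simp: graph_def)

lemma E_in_V: "E x y \<Longrightarrow> x \<in> V" "E x y \<Longrightarrow> y \<in> V"
  using graph by (auto simp: graph_def)

text \<open>Meeting \<open>U\<close> includes being nonempty, so these are exactly the possible
  branch sets of a \<open>U\<close>-rooted minor.\<close>

definition rc :: "'a set \<Rightarrow> bool" where
  "rc C \<longleftrightarrow> conn E C \<and> C \<subseteq> V \<and> C \<inter> U \<noteq> {}"

lemma rc_Un:
  assumes "rc A" "conn E B" "B \<subseteq> V" "a \<in> A" "b \<in> B" "a = b \<or> E a b"
  shows "rc (A \<union> B)"
  using assms conn_Un[OF symp_E] unfolding rc_def by blast

lemma rc_component:
  assumes "rc C" "C \<subseteq> W" "W \<subseteq> V" "x \<in> C"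
  shows "rc (component E W x)"
proof -
  have "C \<subseteq> component E W x"
    using assms conn_subset_component[OF symp_E, of C W x] component_self[of x E W] unfolding rc_def by blast
  then show ?thesis
    using assms component_subset[of x W E] conn_component[OF symp_E] unfolding rc_def by blast
qed

lemma nb_subset_V: "nb E S C \<subseteq> V"
  using E_in_V by (auto simp: nb_def)

end

locale rooted_minors = rooted_graph +
  assumes minors: "is_minor V E VH EH \<Longrightarrow> rooted_minor U VH \<Longrightarrow> countable_colouring_number VH EH"
begin

text \<open>Of a good well-order only this trace is kept: \<open>f X\<close> stands for the finitely
  many neighbours of \<open>X\<close> that precede it, and of two adjacent branch sets one is listed
  by the other.\<close>

definition finite_back_degree :: "'a set set \<Rightarrow> ('a set \<Rightarrow> 'a set set) \<Rightarrow> bool" where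
  "finite_back_degree VH f \<longleftrightarrow> (\<forall>X\<in>VH. finite (f X) \<and> f X \<subseteq> VH) \<and>
    (\<forall>X\<in>VH. \<forall>Y\<in>VH. X \<noteq> Y \<longrightarrow> (\<exists>x\<in>X. \<exists>y\<in>Y. E x y) \<longrightarrow> Y \<in> f X \<or> X \<in> f Y)"

lemma finite_back_degreeD:
  assumes "finite_back_degree VH f"
  shows "\<And>X. X \<in> VH \<Longrightarrow> finite (f X)" "\<And>X. X \<in> VH \<Longrightarrow> f X \<subseteq> VH"
    "\<And>X Y x y. X \<in> VH \<Longrightarrow> Y \<in> VH \<Longrightarrow> X \<noteq> Y \<Longrightarrow> x \<in> X \<Longrightarrow> y \<in> Y \<Longrightarrow> E x y \<Longrightarrow> Y \<in> f X \<or> X \<in> f Y"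
  using assms unfolding finite_back_degree_def by blast+

lemma minor_orientation:
  assumes rc: "\<And>X. X \<in> VH \<Longrightarrow> rc X"
    and disj: "\<And>X Y. X \<in> VH \<Longrightarrow> Y \<in> VH \<Longrightarrow> X \<noteq> Y \<Longrightarrow> X \<inter> Y = {}"
  shows "\<exists>f. finite_back_degree VH f"
proof -
  \<comment> \<open>The minor takes all edges that \<open>G\<close> offers between the branch sets,
    so that the orientation covers every adjacent pair.\<close>
  define EH where "EH X Y \<longleftrightarrow> X \<in> VH \<and> Y \<in> VH \<and> X \<noteq> Y \<and> (\<exists>x\<in>X. \<exists>y\<in>Y. E x y)" for X Y
  have "is_minor V E VH EH"
    using rc disj unfolding is_minor_def graph_def connected_set_iff_conn rc_def EH_def
    by (auto 4 3 intro: E_sym)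
  moreover have "rooted_minor U VH"
    using rc by (auto simp: rooted_minor_def rc_def)
  ultimately obtain R where R: "Well_order R" "Field R = VH"
    and fin: "\<And>v. v \<in> VH \<Longrightarrow> finite {w. EH v w \<and> (w, v) \<in> R \<and> w \<noteq> v}"
    using minors unfolding countable_colouring_number_def by blast
  have total: "(x, y) \<in> R \<or> (y, x) \<in> R" if "x \<in> VH" "y \<in> VH" "x \<noteq> y" for x y
    using R that by (auto simp: well_order_on_def linear_order_on_def total_on_def)
  show ?thesis
    unfolding finite_back_degree_def
  proof (intro exI[of _ "\<lambda>v. {w. EH v w \<and> (w, v) \<in> R \<and> w \<noteq> v}"] conjI ballI impI)
    fix X Y assume "X \<in> VH" "Y \<in> VH" "X \<noteq> Y" "\<exists>x\<in>X. \<exists>y\<in>Y. E x y"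
    then show "Y \<in> {w. EH X w \<and> (w, X) \<in> R \<and> w \<noteq> X} \<or> X \<in> {w. EH Y w \<and> (w, Y) \<in> R \<and> w \<noteq> Y}"
      using total[of X Y] E_sym by (auto simp: EH_def)
  qed (use fin in \<open>auto simp: EH_def\<close>)
qed

text \<open>An uncountable family would give a rooted minor with a countable side and an uncountable
  side, where each vertex of the latter has infinitely many neighbours in the former. The countable
  side lists only countably many vertices, so some vertex of the other side would have to list
  infinitely many.\<close>

lemma no_barricade:
  assumes N: "countable N" and rc: "\<And>A. A \<in> \<D> \<Longrightarrow> rc A"
    and disj: "\<And>A B. A \<in> \<D> \<Longrightarrow> B \<in> \<D> \<Longrightarrow> A \<noteq> B \<Longrightarrow> A \<inter> B = {}"
    and N_disj: "\<And>A. A \<in> \<D> \<Longrightarrow> A \<inter> N = {}"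
    and inf: "\<And>A. A \<in> \<D> \<Longrightarrow> infinite (nb E N A)"
  shows "countable \<D>"
proof (rule ccontr)
  assume unc: "uncountable \<D>"
  define att where "att d = {A \<in> \<D>. \<exists>a\<in>A. E a d}" for d
  \<comment> \<open>Each \<open>d \<in> N\<close> outside \<open>N0\<close> spoils only countably many members of \<open>\<D>\<close>; each \<open>d \<in> N0\<close> can be
    made rooted by contracting it into a private member of \<open>\<D>\<close>.\<close>
  define N0 where "N0 = {d \<in> N. uncountable (att d)}"
  have N0: "countable N0" "N0 \<subseteq> N"
    using N by (auto simp: N0_def intro: countable_subset)
  define bad where "bad = (\<Union>d\<in>N - N0. att d)"
  have bad: "countable bad"
    unfolding bad_def using N by (intro countable_UN) (auto simp: N0_def)
  define \<D>' where "\<D>' = \<D> - bad"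
  have nb_N0: "nb E N A \<subseteq> N0" if "A \<in> \<D>'" for A
    using that by (auto simp: \<D>'_def bad_def att_def nb_def)
  have inf_att: "infinite (att d - bad)" if "d \<in> N0" for d
  proof -
    have "uncountable (att d)"
      using that by (simp add: N0_def)
    then have "uncountable (att d - bad)"
      using uncountable_minus_countable[OF _ bad] by blast
    then show ?thesis
      using countable_finite by blast
  qed
  obtain a where a: "inj_on a N0" "\<And>d. d \<in> N0 \<Longrightarrow> a d \<in> att d - bad"
    using countable_system_of_distinct_representatives[of N0 "\<lambda>d. att d - bad", OF N0(1) inf_att] by blast
  have a\<D>: "a d \<in> \<D>" "\<exists>x\<in>a d. E x d" if "d \<in> N0" for d
    using a(2)[OF that] by (auto simp: att_def)
  define H0 where "H0 = (\<lambda>d. insert d (a d)) ` N0"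
  define H1 where "H1 = \<D>' - a ` N0"
  have "uncountable \<D>'"
    unfolding \<D>'_def using uncountable_minus_countable[OF unc bad] .
  then have H1: "uncountable H1"
    unfolding H1_def using uncountable_minus_countable N0(1) by blast
  have rcH: "rc X" if XH: "X \<in> H0 \<union> H1" for X
  proof (cases "X \<in> H1")
    case True
    then show ?thesis
      using rc by (auto simp: H1_def \<D>'_def)
  next
    case False
    then obtain d where d: "d \<in> N0" "X = insert d (a d)"
      using XH by (auto simp: H0_def)
    then obtain x where x: "x \<in> a d" "E x d"
      using a\<D> by blast
    show ?thesis
      using rc_Un[OF rc[OF a\<D>(1)[OF d(1)]], of "{d}" x d] x E_in_V d(2) by auto
  qed
  have disjH: "X \<inter> Y = {}" if X: "X \<in> H0 \<union> H1" and Y: "Y \<in> H0 \<union> H1" and XY: "X \<noteq> Y" for X Y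
  proof -
    have 00: "insert d (a d) \<inter> insert e (a e) = {}" if "d \<in> N0" "e \<in> N0" "d \<noteq> e" for d e
    proof -
      have "a d \<noteq> a e"
        using a(1) that by (auto simp: inj_on_def)
      then show ?thesis
        using disj[of "a d" "a e"] N_disj[of "a d"] N_disj[of "a e"] a\<D>(1) that N0(2) by auto
    qed
    have 01: "insert d (a d) \<inter> B = {}" if "d \<in> N0" "B \<in> H1" for d B
      using disj[of "a d" B] N_disj[of B] a\<D>(1) that N0(2) unfolding H1_def \<D>'_def by blast
    have 11: "A \<inter> B = {}" if "A \<in> H1" "B \<in> H1" "A \<noteq> B" for A B
      using disj that by (auto simp: H1_def \<D>'_def)
    show ?thesis
    proof (cases "X \<in> H1")
      case X: True
      show ?thesis
      proof (cases "Y \<in> H1")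
        case False
        then obtain d where "d \<in> N0" "Y = insert d (a d)"
          using Y by (auto simp: H0_def)
        then show ?thesis
          using 01[OF _ X, of d] by blast
      qed (use 11 X XY in blast)
    next
      case False
      then obtain d where d: "d \<in> N0" "X = insert d (a d)"
        using X by (auto simp: H0_def)
      show ?thesis
      proof (cases "Y \<in> H1")
        case False
        then obtain e where e: "e \<in> N0" "Y = insert e (a e)"
          using Y by (auto simp: H0_def)
        then show ?thesis
          using 00[of d e] d XY by blast
      qed (use 01[of d Y] d in blast)
    qed
  qed
  have "\<exists>f. finite_back_degree (H0 \<union> H1) f"
    by (rule minor_orientation) (use rcH in blast, use disjH in blast)
  then obtain f where fbd: "finite_back_degree (H0 \<union> H1) f"
    by blast
  note f = finite_back_degreeD(1,3)[OF fbd]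
  \<comment> \<open>Countably many finite lists cannot exhaust \<open>H1\<close>; the member
    \<open>B\<close> found below is listed by no element of \<open>H0\<close> and must list all its
    neighbours there.\<close>
  have "countable (\<Union>X\<in>H0. f X)"
    using N0(1) f(1) by (intro countable_UN) (auto simp: H0_def intro: countable_finite)
  then have "uncountable (H1 - (\<Union>X\<in>H0. f X))"
    using uncountable_minus_countable[OF H1] by blast
  then obtain B where B: "B \<in> H1" "\<And>X. X \<in> H0 \<Longrightarrow> B \<notin> f X"
    by (metis (no_types, lifting) DiffE UN_I countable_empty ex_in_conv)
  have "insert d (a d) \<in> f B" if dB: "d \<in> nb E N B" for d
  proof -
    have d: "d \<in> N0"
      using nb_N0[of B] B(1) that by (auto simp: H1_def)
    obtain b where b: "b \<in> B" "E b d"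
      using dB by (auto simp: nb_def)
    have X: "insert d (a d) \<in> H0"
      using d by (simp add: H0_def)
    have "d \<notin> B"
      using N_disj[of B] B(1) d N0(2) by (auto simp: H1_def \<D>'_def)
    then have "B \<noteq> insert d (a d)"
      by blast
    then show ?thesis
      using f(2)[of B "insert d (a d)" b d] B X b by blast
  qed
  then have "(\<lambda>d. insert d (a d)) ` nb E N B \<subseteq> f B"
    by blast
  moreover have "inj_on (\<lambda>d. insert d (a d)) (nb E N B)"
  proof (rule inj_onI)
    fix d e assume de: "d \<in> nb E N B" "e \<in> nb E N B" "insert d (a d) = insert e (a e)"
    then have "d \<in> N" "e \<in> N0"
      using nb_N0[of B] B(1) by (auto simp: H1_def nb_def)
    then have "d \<notin> a e"
      using N_disj[OF a\<D>(1)] by blast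
    then show "d = e"
      using de(3) by blast
  qed
  moreover have "finite (f B)"
    using f(1) B(1) by blast
  ultimately have "finite (nb E N B)"
    using finite_subset finite_imageD by blast
  then show False
    using inf B(1) by (auto simp: H1_def \<D>'_def)
qed

text \<open>Finite paths in \<open>C\<close> from one root to a neighbour of each of the countably
  many vertices in \<open>nb E N C\<close> have a connected, countable and rooted union.\<close>

lemma rc_countable_core:
  assumes "rc C" "countable N"
  shows "\<exists>A. rc A \<and> A \<subseteq> C \<and> countable A \<and> nb E N A = nb E N C"
proof -
  obtain u where u: "u \<in> C" "u \<in> U"
    using assms(1) by (auto simp: rc_def)
  have "\<exists>P. conn E P \<and> P \<subseteq> C \<and> countable P \<and> u \<in> P \<and> (\<exists>c\<in>P. E c n)" if n: "n \<in> nb E N C" for n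
  proof -
    obtain c where c: "c \<in> C" "E c n"
      using n by (auto simp: nb_def)
    then have "(u, c) \<in> (edges_in E C)\<^sup>*"
      using assms(1) u by (auto simp: rc_def conn_def)
    then obtain ps where ps: "is_path E ps" "set ps \<subseteq> C" "hd ps = u" "last ps = c"
      using rtrancl_edges_in_path u(1) by metis
    have "conn E (component E (set ps) u)" "c \<in> component E (set ps) u" "u \<in> set ps"
      using path_rtrancl_edges_in[of E ps "set ps"] ps conn_component[OF symp_E]
      by (auto simp: component_def is_path_successively)
    then show ?thesis
      using ps(2) c(2) component_subset[of u "set ps" E]
      by (intro exI[of _ "component E (set ps) u"]) (auto intro: countable_subset[of _ "set ps"] countable_finite)
  qed
  then obtain P where P: "\<And>n. n \<in> nb E N C \<Longrightarrow> conn E (P n) \<and> P n \<subseteq> C \<and> countable (P n) \<and> u \<in> P n \<and> (\<exists>c\<in>P n. E c n)"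
    by metis
  define A where "A = insert u (\<Union>n\<in>nb E N C. P n)"
  have "countable (nb E N C)"
    using assms(2) by (rule countable_subset[rotated]) (auto simp: nb_def)
  then have "countable A"
    unfolding A_def using P by (intro countable_insert countable_UN) auto
  moreover have AC: "A \<subseteq> C"
    using P u by (auto simp: A_def)
  moreover have "nb E N A = nb E N C"
  proof
    show "nb E N A \<subseteq> nb E N C"
      using AC by (intro nb_mono) auto
    show "nb E N C \<subseteq> nb E N A"
    proof
      fix n assume n: "n \<in> nb E N C"
      then obtain c where "c \<in> P n" "E c n"
        using P by blast
      then show "n \<in> nb E N A"
        using n by (auto simp: nb_def A_def)
    qed
  qed
  moreover have "conn E A"
  proof -
    have "(x, u) \<in> (edges_in E A)\<^sup>* \<and> (u, x) \<in> (edges_in E A)\<^sup>*" if "x \<in> A" for x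
    proof (cases "x = u")
      case False
      then obtain n where n: "n \<in> nb E N C" "x \<in> P n"
        using \<open>x \<in> A\<close> by (auto simp: A_def)
      have "P n \<subseteq> A"
        using n by (auto simp: A_def)
      then show ?thesis
        using P[OF n(1)] n(2) edges_in_rtrancl_mono[of _ _ E "P n" A] by (auto simp: conn_def)
    qed simp
    then show ?thesis
      unfolding conn_def by (meson rtrancl_trans)
  qed
  ultimately show ?thesis
    using u assms(1) by (intro exI[of _ A]) (auto simp: rc_def A_def)
qed

text \<open>\<open>D\<close> is essentially the union of a maximal disjoint family of countable
  rooted connected sets with infinitely many neighbours in the boundary. The family is countable by
  \<open>no_barricade\<close>, and maximality makes it meet every competitor.\<close>

lemma countable_hitting_set:
  assumes K: "rc K" "countable (bd E K)"
  shows "\<exists>D. D \<subseteq> K \<and> countable D \<and> D \<noteq> {} \<and> (\<forall>x\<in>D. \<exists>A. x \<in> A \<and> A \<subseteq> D \<and> rc A) \<and>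
    (\<forall>C. rc C \<longrightarrow> C \<subseteq> K \<longrightarrow> infinite (nb E (bd E K) C) \<longrightarrow>
      (\<exists>A. rc A \<and> A \<subseteq> D \<and> infinite (nb E (bd E K) A) \<and> A \<inter> C \<noteq> {}))"
proof -
  let ?N = "bd E K"
  define adm where "adm A \<longleftrightarrow> rc A \<and> A \<subseteq> K \<and> countable A \<and> infinite (nb E ?N A)" for A
  define \<A> where "\<A> = {\<D>. (\<forall>A\<in>\<D>. adm A) \<and> (\<forall>A\<in>\<D>. \<forall>B\<in>\<D>. A \<noteq> B \<longrightarrow> A \<inter> B = {})}"
  have "\<exists>M\<in>\<A>. \<forall>X\<in>\<A>. M \<subseteq> X \<longrightarrow> X = M"
  proof (rule subset_Zorn_nonempty)
    show "\<A> \<noteq> {}"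
      by (auto simp: \<A>_def intro: exI[of _ "{}"])
  next
    fix \<C> assume "\<C> \<noteq> {}" and ch: "subset.chain \<A> \<C>"
    have "A \<inter> B = {}" if "X \<in> \<C>" "Y \<in> \<C>" "A \<in> X" "B \<in> Y" "A \<noteq> B" for A B X Y
    proof -
      have "X \<subseteq> Y \<or> Y \<subseteq> X" "X \<in> \<A>" "Y \<in> \<A>"
        using that ch by (auto simp: subset_chain_def)
      then show ?thesis
        using that unfolding \<A>_def by blast
    qed
    moreover have "adm A" if "X \<in> \<C>" "A \<in> X" for A X
      using that ch by (auto simp: subset_chain_def \<A>_def)
    ultimately show "\<Union>\<C> \<in> \<A>"
      unfolding \<A>_def by blast
  qed
  then obtain \<D> where \<D>: "\<D> \<in> \<A>" and max: "\<And>X. X \<in> \<A> \<Longrightarrow> \<D> \<subseteq> X \<Longrightarrow> X = \<D>"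
    by blast
  have adm: "adm A" if "A \<in> \<D>" for A
    using \<D> that by (auto simp: \<A>_def)
  have "countable \<D>"
  proof (rule no_barricade[OF K(2)])
    show "A \<inter> B = {}" if "A \<in> \<D>" "B \<in> \<D>" "A \<noteq> B" for A B
      using \<D> that by (auto simp: \<A>_def)
    show "A \<inter> ?N = {}" if "A \<in> \<D>" for A
      using adm[OF that] by (auto simp: adm_def nb_def)
  qed (use adm in \<open>auto simp: adm_def\<close>)
  obtain u where u: "u \<in> K" "u \<in> U"
    using K by (auto simp: rc_def)
  \<comment> \<open>The family may be empty; the root \<open>u\<close> keeps \<open>D\<close>
    nonempty, and \<open>{u}\<close> is a rooted piece of its own.\<close>
  define D where "D = insert u (\<Union>\<D>)"
  have "D \<subseteq> K"
    using adm u by (auto simp: D_def adm_def)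
  moreover have "countable D"
    unfolding D_def using countable_UN[OF \<open>countable \<D>\<close>, of "\<lambda>A. A"] adm by (auto simp: adm_def)
  moreover have "\<exists>A. x \<in> A \<and> A \<subseteq> D \<and> rc A" if xD: "x \<in> D" for x
  proof (cases "x = u")
    case True
    then show ?thesis
      using u U_subset by (intro exI[of _ "{u}"]) (auto simp: rc_def D_def)
  next
    case False
    then obtain A where "x \<in> A" "A \<in> \<D>"
      using xD by (auto simp: D_def)
    then show ?thesis
      using adm[of A] by (intro exI[of _ A]) (auto simp: adm_def D_def)
  qed
  moreover have "\<exists>A. rc A \<and> A \<subseteq> D \<and> infinite (nb E ?N A) \<and> A \<inter> C \<noteq> {}"
    if C: "rc C" "C \<subseteq> K" "infinite (nb E ?N C)" for C
  proof -
    \<comment> \<open>Maximality speaks of countable sets only, so \<open>C\<close> is replaced by a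
      countable core with the same boundary neighbours.\<close>
    obtain B where B: "rc B" "B \<subseteq> C" "countable B" "nb E ?N B = nb E ?N C"
      using rc_countable_core[OF C(1) K(2)] by blast
    have admB: "adm B"
      using B C by (auto simp: adm_def)
    have "\<exists>A\<in>\<D>. A \<inter> B \<noteq> {}"
    proof (rule ccontr)
      assume non: "\<not> ?thesis"
      then have "insert B \<D> \<in> \<A>"
        using admB \<D> by (auto simp: \<A>_def)
      then have "B \<in> \<D>"
        using max[of "insert B \<D>"] by blast
      then show False
        using non B(1) by (auto simp: rc_def)
    qed
    then obtain A where "A \<in> \<D>" "A \<inter> B \<noteq> {}"
      by blast
    then show ?thesis
      using adm[of A] B(2) by (intro exI[of _ A]) (auto simp: adm_def D_def)
  qed
  ultimately show ?thesis
    by (intro exI[of _ D]) (auto simp: D_def)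
qed

end

section \<open>The transfinite exhaustion\<close>

context rooted_minors
begin

section \<open>Hitting sets of rooted components\<close>

definition hit :: "'a set \<Rightarrow> 'a set" where
  "hit K = (SOME D. D \<subseteq> K \<and> countable D \<and> D \<noteq> {} \<and> (\<forall>x\<in>D. \<exists>A. x \<in> A \<and> A \<subseteq> D \<and> rc A) \<and>
    (\<forall>C. rc C \<longrightarrow> C \<subseteq> K \<longrightarrow> infinite (nb E (bd E K) C) \<longrightarrow>
      (\<exists>A. rc A \<and> A \<subseteq> D \<and> infinite (nb E (bd E K) A) \<and> A \<inter> C \<noteq> {})))"

lemma
  assumes "rc K" "countable (bd E K)"
  shows hit_subset: "hit K \<subseteq> K"
    and countable_hit: "countable (hit K)"
    and hit_nonempty: "hit K \<noteq> {}"
    and hit_piece: "x \<in> hit K \<Longrightarrow> \<exists>A. x \<in> A \<and> A \<subseteq> hit K \<and> rc A"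
    and hit_meets: "rc C \<Longrightarrow> C \<subseteq> K \<Longrightarrow> infinite (nb E (bd E K) C) \<Longrightarrow>
      \<exists>A. rc A \<and> A \<subseteq> hit K \<and> infinite (nb E (bd E K) A) \<and> A \<inter> C \<noteq> {}"
proof -
  note * = someI_ex[OF countable_hitting_set[OF assms], folded hit_def]
  show "hit K \<subseteq> K"
    using * by (elim conjE)
  show "countable (hit K)"
    using * by (elim conjE)
  show "hit K \<noteq> {}"
    using * by (elim conjE)
  show "x \<in> hit K \<Longrightarrow> \<exists>A. x \<in> A \<and> A \<subseteq> hit K \<and> rc A"
    using * by (elim conjE) (drule (1) bspec, assumption)
  show "rc C \<Longrightarrow> C \<subseteq> K \<Longrightarrow> infinite (nb E (bd E K) C) \<Longrightarrow>
      \<exists>A. rc A \<and> A \<subseteq> hit K \<and> infinite (nb E (bd E K) A) \<and> A \<inter> C \<noteq> {}"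
    using * by (elim conjE) (drule spec, drule (1) mp, drule (1) mp, drule (1) mp, assumption)
qed

lemma finite_nb_if_avoids_hit:
  assumes "rc K" "countable (bd E K)" "rc C" "C \<subseteq> K" "C \<inter> hit K = {}"
  shows "finite (nb E (bd E K) C)"
  using hit_meets[OF assms(1-4)] assms(5) by blast

abbreviation cmp :: "'a set \<Rightarrow> 'a \<Rightarrow> 'a set" where
  "cmp X \<equiv> component E (V - X)"

lemma cmp_subset: "x \<in> V - X \<Longrightarrow> cmp X x \<subseteq> V - X"
  by (rule component_subset)

lemma rc_cmp: "x \<in> V - X \<Longrightarrow> cmp X x \<inter> U \<noteq> {} \<Longrightarrow> rc (cmp X x)"
  using cmp_subset[of x X] conn_component[OF symp_E] by (auto simp: rc_def)

lemma bd_cmp_subset: "x \<in> V - X \<Longrightarrow> bd E (cmp X x) \<subseteq> X"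
  using bd_component_disjoint[of x "V - X" E] nb_subset_V[of "- cmp X x" "cmp X x"] by blast

lemma conn_subset_cmp:
  assumes "conn E C" "C \<subseteq> V - X" "x \<in> C"
  shows "C \<subseteq> cmp X x"
proof (rule conn_subset_component[OF symp_E assms(1,2)])
  show "C \<inter> cmp X x \<noteq> {}"
    using assms(3) component_self by (metis IntI empty_iff)
qed

lemma cmp_antimono:
  assumes "X \<subseteq> Y" "x \<in> V - Y"
  shows "cmp Y x \<subseteq> cmp X x"
proof (rule conn_subset_cmp)
  show "cmp Y x \<subseteq> V - X"
    using cmp_subset[OF assms(2)] assms(1) by blast
qed (auto intro: conn_component symp_E)

lemma cmp_eq: "y \<in> cmp X x \<Longrightarrow> cmp X y = cmp X x"
  by (rule component_eq[OF symp_E])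

section \<open>The chain of stages\<close>

definition step :: "'a set \<Rightarrow> 'a set" where
  "step X = X \<union> {y \<in> V - X. cmp X y \<inter> U \<noteq> {} \<and> y \<in> hit (cmp X y)}"

text \<open>Closure under \<open>step\<close> and arbitrary unions replaces a recursion over
  ordinals; the empty union provides the start \<open>{}\<close>, and unions provide the
  limits.\<close>

inductive tower :: "'a set \<Rightarrow> bool" where
  tower_Union: "(\<And>X. X \<in> M \<Longrightarrow> tower X) \<Longrightarrow> tower (\<Union>M)"
| tower_step: "tower X \<Longrightarrow> tower (step X)"

lemma subset_step: "X \<subseteq> step X"
  by (auto simp: step_def)

lemma tower_subset_V: "tower X \<Longrightarrow> X \<subseteq> V"
  by (induction rule: tower.induct) (auto simp: step_def)

text \<open>First half of the classical argument that such a tower is a chain: a set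
  \<open>Y\<close> that contains the successor of each member properly below it is comparable with
  all members. \<open>step_subset_if_psubset\<close> then shows that every member is such a
  \<open>Y\<close>.\<close>

lemma tower_compare_aux:
  assumes Y: "\<And>X. tower X \<Longrightarrow> X \<subset> Y \<Longrightarrow> step X \<subseteq> Y" and "tower X"
  shows "X \<subseteq> Y \<or> step Y \<subseteq> X"
  using assms(2)
proof (induction rule: tower.induct)
  case (tower_Union M)
  then show ?case by blast
next
  case (tower_step X)
  then show ?case
    using Y[of X] subset_step[of X] by blast
qed

lemma step_subset_if_psubset:
  assumes "tower Y" "tower X" "X \<subset> Y"
  shows "step X \<subseteq> Y"
  using assms
proof (induction arbitrary: X rule: tower.induct)
  case (tower_Union M)
  show ?case
  proof (rule ccontr)
    assume not: "\<not> step X \<subseteq> \<Union>M"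
    have "Y \<subseteq> X" if Y: "Y \<in> M" for Y
    proof -
      have *: "X \<subseteq> Y \<or> step Y \<subseteq> X"
        using tower_compare_aux[OF tower_Union.IH[OF Y] tower_Union.prems(1)] .
      show ?thesis
      proof (cases "X = Y")
        case False
        then show ?thesis
          using * tower_Union.IH[OF Y tower_Union.prems(1)] not Y subset_step[of Y] by blast
      qed simp
    qed
    then show False
      using tower_Union.prems by blast
  qed
next
  case (tower_step Y)
  then show ?case
    using tower_compare_aux[OF tower_step.IH tower_step.prems(1)] subset_step[of Y] by blast
qed

lemma tower_linear: "tower X \<Longrightarrow> tower Y \<Longrightarrow> X \<subseteq> Y \<or> step Y \<subseteq> X"
  by (rule tower_compare_aux[OF step_subset_if_psubset])

text \<open>The largest stage that avoids \<open>x\<close>. For \<open>x \<in> top_set\<close> it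
  plays the part of the ordinal rank: \<open>x\<close> is removed in the step that follows
  it.\<close>

definition pre :: "'a \<Rightarrow> 'a set" where
  "pre x = \<Union>{X. tower X \<and> x \<notin> X}"

definition top_set :: "'a set" where
  "top_set = \<Union>{X. tower X}"

lemma tower_pre: "tower (pre x)"
  unfolding pre_def by (rule tower.tower_Union) auto

lemma not_in_pre: "x \<notin> pre x"
  by (auto simp: pre_def)

lemma tower_top_set: "tower top_set"
  unfolding top_set_def by (rule tower.tower_Union) auto

lemma tower_subset_top_set: "tower X \<Longrightarrow> X \<subseteq> top_set"
  by (auto simp: top_set_def)

lemma tower_subset_pre: "tower X \<Longrightarrow> x \<notin> X \<Longrightarrow> X \<subseteq> pre x"
  by (auto simp: pre_def)

lemma step_pre_subset: "tower X \<Longrightarrow> x \<in> X \<Longrightarrow> step (pre x) \<subseteq> X"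
  using tower_linear[OF _ tower_pre, of X x] not_in_pre[of x] by blast

text \<open>Otherwise \<open>pre x\<close> would be a fixed point of \<open>step\<close>, and every
  stage would stay inside it.\<close>

lemma in_step_pre:
  assumes "x \<in> top_set"
  shows "x \<in> step (pre x)"
proof (rule ccontr)
  assume "x \<notin> step (pre x)"
  then have stop: "step (pre x) \<subseteq> pre x"
    using tower_subset_pre[OF tower_step[OF tower_pre]] by blast
  have "X \<subseteq> pre x" if "tower X" for X
    using that
  proof (induction rule: tower.induct)
    case (tower_step X)
    then show ?case
      using stop step_subset_if_psubset[OF tower_pre tower_step.hyps, of x] by (cases "X = pre x") auto
  qed auto
  then show False
    using assms not_in_pre by (auto simp: top_set_def)
qed

lemma pre_eq:
  assumes "tower X" "x \<in> step X" "x \<notin> X"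
  shows "pre x = X"
proof (rule ccontr)
  assume "pre x \<noteq> X"
  then have "step X \<subseteq> pre x"
    using tower_subset_pre[OF assms(1,3)] step_subset_if_psubset[OF tower_pre assms(1)] by blast
  then show False
    using assms(2) not_in_pre by blast
qed

section \<open>Components at the time of removal and their boundaries\<close>

abbreviation K :: "'a \<Rightarrow> 'a set" where
  "K x \<equiv> cmp (pre x) x"

lemma cmp_Int_step:
  assumes "x \<in> V - X"
  shows "cmp X x \<inter> step X = (if cmp X x \<inter> U \<noteq> {} then cmp X x \<inter> hit (cmp X x) else {})"
proof -
  have "y \<in> step X \<longleftrightarrow> cmp X x \<inter> U \<noteq> {} \<and> y \<in> hit (cmp X x)" if y: "y \<in> cmp X x" for y
  proof -
    have "cmp X y = cmp X x" "y \<in> V" "y \<notin> X"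
      using cmp_eq[OF y] y cmp_subset[OF assms] by auto
    then show ?thesis
      unfolding step_def by simp
  qed
  then show ?thesis
    by auto
qed

text \<open>In a chain of finite sets the cardinality determines the set.\<close>

lemma countable_chain_of_finite:
  assumes "\<And>A. A \<in> \<F> \<Longrightarrow> finite A" and "\<And>A B. A \<in> \<F> \<Longrightarrow> B \<in> \<F> \<Longrightarrow> A \<subseteq> B \<or> B \<subseteq> A"
  shows "countable (\<Union>\<F>)"
proof -
  have "inj_on card \<F>"
    using assms by (intro inj_onI) (metis card_subset_eq)
  then have "countable \<F>"
    by (rule countableI)
  then show ?thesis
    using countable_UN[of \<F> "\<lambda>A. A"] assms(1) countable_finite by auto
qed

text \<open>At a successor stage the boundary gains at most one hitting set. At a limit, an
  uncountable boundary would meet every earlier stage in a finite set only, and would thus be the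
  union of a chain of finite sets.\<close>

lemma countable_bd_cmp:
  assumes "tower X" "x \<in> V - X"
  shows "countable (bd E (cmp X x))"
proof -
  \<comment> \<open>The induction covers all stages inside \<open>X\<close>, because the limit case
    needs the claim for some \<open>pre z\<close> that need not belong to \<open>M\<close>.\<close>
  have "\<forall>Y. tower Y \<longrightarrow> Y \<subseteq> X \<longrightarrow> (\<forall>x\<in>V - Y. countable (bd E (cmp Y x)))"
    using assms(1)
  proof (induction rule: tower.induct)
    case (tower_step X)
    note cX = tower_step.IH[rule_format, OF tower_step.hyps order_refl]
    have new: "countable (bd E (cmp (step X) x))" if x: "x \<in> V - step X" for x
    proof -
      have xX: "x \<in> V - X"
        using x subset_step by blast
      have "bd E (cmp (step X) x) \<subseteq> bd E (cmp X x) \<union> (cmp X x \<inter> step X)"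
      proof
        fix y assume y: "y \<in> bd E (cmp (step X) x)"
        then have "y \<in> step X"
          using bd_cmp_subset[OF x] by blast
        moreover have "cmp (step X) x \<subseteq> cmp X x"
          using cmp_antimono[OF subset_step x] .
        ultimately show "y \<in> bd E (cmp X x) \<union> (cmp X x \<inter> step X)"
          using y by (auto simp: nb_def)
      qed
      moreover have "countable (cmp X x \<inter> step X)"
        unfolding cmp_Int_step[OF xX]
        using countable_hit[OF rc_cmp[OF xX] cX[OF xX]] by (auto intro: countable_subset)
      ultimately show ?thesis
        using cX[OF xX] by (meson countable_Un countable_subset)
    qed
    show ?case
    proof (intro allI impI)
      fix Y assume Y: "tower Y" "Y \<subseteq> step X"
      show "\<forall>x\<in>V - Y. countable (bd E (cmp Y x))"
      proof (cases "Y \<subseteq> X")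
        case True
        then show ?thesis
          using tower_step.IH Y by blast
      next
        case False
        then have "Y = step X"
          using tower_linear[OF Y(1) tower_step.hyps] Y(2) by blast
        then show ?thesis
          using new by blast
      qed
    qed
  next
    case (tower_Union M)
    let ?X = "\<Union>M"
    note IH = tower_Union.IH[rule_format]
    have towM: "tower Y" if "Y \<in> M" for Y
      using tower_Union.hyps that by blast
    have new: "countable (bd E (cmp ?X x))" if x: "x \<in> V - ?X" for x
    proof (rule ccontr)
      let ?K = "cmp ?X x"
      assume unc: "uncountable (bd E ?K)"
      have KX: "?K \<subseteq> V - ?X"
        using cmp_subset[OF x] .
      have KY: "?K \<subseteq> cmp Y x" "x \<in> V - Y" if "Y \<in> M" for Y
      proof -
        show xY: "x \<in> V - Y"
          using x that by blast
        show "?K \<subseteq> cmp Y x"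
          using cmp_antimono[OF _ x, of Y] that by blast
      qed
      have sub: "bd E ?K \<inter> Y \<subseteq> bd E (cmp Y x)" if Y: "Y \<in> M" for Y
        using KY[OF Y] cmp_subset[OF KY(2)[OF Y]] by (auto simp: nb_def)
      have cnt: "countable (bd E ?K \<inter> Y)" if Y: "Y \<in> M" for Y
        using sub[OF Y] IH[OF Y towM[OF Y] order_refl KY(2)[OF Y]] by (rule countable_subset)
      \<comment> \<open>Each stage holds only countably many boundary vertices, so uncountability
        yields boundary vertices beyond any given stage in \<open>M\<close>.\<close>
      have ex: "\<exists>z\<in>bd E ?K. z \<notin> Y \<and> (\<exists>Y2\<in>M. z \<in> Y2)" if Y: "Y \<in> M" for Y
      proof -
        have "bd E ?K \<noteq> bd E ?K \<inter> Y"
          using cnt[OF Y] unc by metis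
        then obtain z where "z \<in> bd E ?K" "z \<notin> Y"
          by blast
        then show ?thesis
          using bd_cmp_subset[OF x] by blast
      qed
      \<comment> \<open>\<open>?K\<close> itself need not be rooted, so it is enlarged by a rooted piece \<open>A\<close> of a later layer.\<close>
      have fin: "finite (bd E ?K \<inter> Y)" if Y: "Y \<in> M" for Y
      proof -
        \<comment> \<open>Two stages are passed: \<open>Y1\<close> contains \<open>step Y\<close>
          and \<open>z\<close> lies beyond \<open>Y1\<close>. Hence the piece around
          \<open>z\<close> avoids \<open>step Y\<close>, in particular the hitting set of
          \<open>cmp Y x\<close>.\<close>
        obtain z1 Y1 where z1: "z1 \<notin> Y" "Y1 \<in> M" "z1 \<in> Y1"
          using ex[OF Y] by blast
        then have Y1: "step Y \<subseteq> Y1"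
          using tower_linear[OF towM towM, of Y1 Y] Y by blast
        obtain z Y2 where z: "z \<in> bd E ?K" "z \<notin> Y1" "Y2 \<in> M" "z \<in> Y2"
          using ex[OF z1(2)] by blast
        have zV: "z \<in> V - pre z"
          using z(1) nb_subset_V not_in_pre by blast
        have Y1z: "Y1 \<subseteq> pre z"
          using tower_subset_pre[OF towM[OF z1(2)] z(2)] .
        have "z \<in> step (pre z)"
          using in_step_pre tower_subset_top_set[OF towM[OF z(3)]] z(4) by blast
        then have rcz: "K z \<inter> U \<noteq> {}" "z \<in> hit (K z)"
          using not_in_pre[of z] by (auto simp: step_def)
        have "pre z \<subseteq> Y2"
          using step_pre_subset[OF towM[OF z(3)] z(4)] subset_step by blast
        then have cz: "countable (bd E (K z))"
          using IH[OF z(3) tower_pre _ zV] by blast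
        obtain A where A: "z \<in> A" "A \<subseteq> hit (K z)" "rc A"
          using hit_piece[OF rc_cmp[OF zV rcz(1)] cz rcz(2)] by blast
        have AV: "A \<subseteq> V - pre z"
          using A(2) hit_subset[OF rc_cmp[OF zV rcz(1)] cz] cmp_subset[OF zV] by blast
        obtain k where k: "k \<in> ?K" "E k z"
          using z(1) by (auto simp: nb_def)
        have rcAK: "rc (A \<union> ?K)"
          using rc_Un[OF A(3) conn_component[OF symp_E], of "V - ?X" x z k] KX A(1) k E_sym by blast
        have avoid: "A \<union> ?K \<subseteq> V - step Y"
          using AV KX Y1 Y1z z1(2) by blast
        have xY: "x \<in> V - Y"
          using KY(2)[OF Y] .
        have AKY: "A \<union> ?K \<subseteq> cmp Y x"
          using conn_subset_cmp[of "A \<union> ?K" Y x] rcAK avoid subset_step[of Y] component_self[of x E "V - ?X"]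
          unfolding rc_def by blast
        then have ne: "cmp Y x \<inter> U \<noteq> {}"
          using rcAK by (auto simp: rc_def)
        have "(A \<union> ?K) \<inter> hit (cmp Y x) = {}"
          using cmp_Int_step[OF xY] ne avoid AKY by auto
        then have "finite (nb E (bd E (cmp Y x)) (A \<union> ?K))"
          using finite_nb_if_avoids_hit[OF rc_cmp[OF xY ne] IH[OF Y towM[OF Y] order_refl xY] rcAK AKY]
          by blast
        moreover have "bd E ?K \<inter> Y \<subseteq> nb E (bd E (cmp Y x)) (A \<union> ?K)"
          using sub[OF Y] by (auto simp: nb_def)
        ultimately show ?thesis
          by (rule finite_subset[rotated])
      qed
      have "countable (\<Union>((\<lambda>Y. bd E ?K \<inter> Y) ` M))"
      proof (rule countable_chain_of_finite)
        fix A B assume "A \<in> (\<lambda>Y. bd E ?K \<inter> Y) ` M" "B \<in> (\<lambda>Y. bd E ?K \<inter> Y) ` M"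
        then obtain Y Z where YZ: "Y \<in> M" "Z \<in> M" "A = bd E ?K \<inter> Y" "B = bd E ?K \<inter> Z"
          by blast
        have "Y \<subseteq> Z \<or> Z \<subseteq> Y"
          using tower_linear[OF towM[OF YZ(1)] towM[OF YZ(2)]] subset_step[of Z] by blast
        then show "A \<subseteq> B \<or> B \<subseteq> A"
          using YZ by blast
      qed (use fin in blast)
      moreover have "bd E ?K \<subseteq> \<Union>((\<lambda>Y. bd E ?K \<inter> Y) ` M)"
        using bd_cmp_subset[OF x] by blast
      ultimately show False
        using unc countable_subset by blast
    qed
    show ?case
    proof (intro allI impI)
      fix Y assume Y: "tower Y" "Y \<subseteq> ?X"
      show "\<forall>x\<in>V - Y. countable (bd E (cmp Y x))"
      proof (cases "\<exists>Z\<in>M. Y \<subseteq> Z")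
        case True
        then show ?thesis
          using IH Y(1) by blast
      next
        case False
        then have "Z \<subseteq> Y" if "Z \<in> M" for Z
          using tower_linear[OF towM[OF that] Y(1)] that subset_step[of Y] tower_linear[OF Y(1) towM[OF that]]
          by blast
        then have "Y = ?X"
          using Y(2) by blast
        then show ?thesis
          using new by blast
      qed
    qed
  qed
  then show ?thesis
    using assms by blast
qed

lemma top_set_layer:
  assumes "x \<in> top_set"
  shows "x \<in> V - pre x" "rc (K x)" "x \<in> hit (K x)" "countable (bd E (K x))" "K x \<inter> step (pre x) = hit (K x)"
proof -
  show xV: "x \<in> V - pre x"
    using assms not_in_pre tower_subset_V[OF tower_top_set] by blast
  have *: "K x \<inter> U \<noteq> {}" "x \<in> hit (K x)"
    using in_step_pre[OF assms] not_in_pre[of x] by (auto simp: step_def)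
  then show rc: "rc (K x)" and "x \<in> hit (K x)"
    using rc_cmp[OF xV] by auto
  show c: "countable (bd E (K x))"
    using countable_bd_cmp[OF tower_pre xV] .
  show "K x \<inter> step (pre x) = hit (K x)"
    using cmp_Int_step[OF xV] * hit_subset[OF rc c] by auto
qed

text \<open>A root left over would lie in a rooted component of the remainder, whose nonempty
  hitting set would be added by one more step.\<close>

lemma U_subset_top_set: "U \<subseteq> top_set"
proof
  fix u assume u: "u \<in> U"
  show "u \<in> top_set"
  proof (rule ccontr)
    assume "u \<notin> top_set"
    then have uV: "u \<in> V - top_set"
      using u U_subset by blast
    have rc: "cmp top_set u \<inter> U \<noteq> {}"
      using u component_self[of u E "V - top_set"] by blast
    have c: "countable (bd E (cmp top_set u))"
      using countable_bd_cmp[OF tower_top_set uV] .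
    obtain y where y: "y \<in> hit (cmp top_set u)"
      using hit_nonempty[OF rc_cmp[OF uV rc] c] by blast
    have yc: "y \<in> cmp top_set u"
      using y hit_subset[OF rc_cmp[OF uV rc] c] by blast
    then have "y \<in> step top_set"
      using y rc cmp_Int_step[OF uV] by auto
    then have "y \<in> top_set"
      using tower_subset_top_set[OF tower_step[OF tower_top_set]] by blast
    then show False
      using yc cmp_subset[OF uV] by blast
  qed
qed

lemma hit_subset_top_set:
  assumes "tower X" "x \<in> V - X" "cmp X x \<inter> U \<noteq> {}"
  shows "hit (cmp X x) \<subseteq> top_set"
proof -
  have "hit (cmp X x) \<subseteq> cmp X x"
    using hit_subset[OF rc_cmp[OF assms(2,3)] countable_bd_cmp[OF assms(1,2)]] .
  then have "hit (cmp X x) \<subseteq> step X"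
    using cmp_Int_step[OF assms(2)] assms(3) by auto
  then show ?thesis
    using tower_subset_top_set[OF tower_step[OF assms(1)]] by blast
qed

lemma layer_eq:
  assumes "tower X" "x \<in> V - X" "cmp X x \<inter> U \<noteq> {}" "y \<in> hit (cmp X x)"
  shows "pre y = X" "K y = cmp X x"
proof -
  have "hit (cmp X x) \<subseteq> cmp X x"
    using hit_subset[OF rc_cmp[OF assms(2,3)] countable_bd_cmp[OF assms(1,2)]] .
  then have y: "y \<in> cmp X x" "y \<notin> X" "y \<in> step X"
    using cmp_Int_step[OF assms(2)] assms(3,4) cmp_subset[OF assms(2)] by auto
  then show "pre y = X"
    using pre_eq[OF assms(1)] by blast
  then show "K y = cmp X x"
    using cmp_eq[OF y(1)] by simp
qed

end

section \<open>A closure operator with finite adhesion\<close>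

context rooted_minors
begin

text \<open>Taken over all \<open>x \<in> top_set\<close>, these are the branch sets of the single
  minor to which the hypothesis on colouring numbers is applied.\<close>

definition piece :: "'a \<Rightarrow> 'a set" where
  "piece x = component E (hit (K x)) x"

lemma hit_subset_step_pre: "x \<in> top_set \<Longrightarrow> hit (K x) \<subseteq> step (pre x)"
  using top_set_layer(5) by blast

lemma hit_K_subset_top_set: "x \<in> top_set \<Longrightarrow> hit (K x) \<subseteq> top_set"
  using hit_subset_step_pre tower_subset_top_set[OF tower_step[OF tower_pre]] by blast

lemma hit_K_eq:
  assumes "x \<in> top_set" "y \<in> hit (K x)"
  shows "pre y = pre x" "K y = K x"
proof -
  have "K x \<inter> U \<noteq> {}"
    using top_set_layer(2)[OF assms(1)] by (auto simp: rc_def)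
  then show "pre y = pre x" "K y = K x"
    using layer_eq[OF tower_pre top_set_layer(1)[OF assms(1)] _ assms(2)] by auto
qed

lemma piece_subset_hit: "x \<in> top_set \<Longrightarrow> piece x \<subseteq> hit (K x)"
  unfolding piece_def using component_subset[OF top_set_layer(3)] .

lemma piece_self: "x \<in> piece x"
  by (simp add: piece_def)

lemma piece_eq:
  assumes "x \<in> top_set" "y \<in> piece x"
  shows "piece y = piece x"
proof -
  have "K y = K x"
    using hit_K_eq[OF assms(1)] piece_subset_hit[OF assms(1)] assms(2) by blast
  then show ?thesis
    using component_eq[OF symp_E] assms(2) by (simp add: piece_def)
qed

lemma conn_subset_piece:
  assumes "conn E A" "A \<subseteq> hit (K x)" "x \<in> A"
  shows "A \<subseteq> piece x"
  unfolding piece_def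
proof (rule conn_subset_component[OF symp_E assms(1,2)])
  show "A \<inter> component E (hit (K x)) x \<noteq> {}"
    using assms(3) component_self by (metis IntI empty_iff)
qed

lemma rc_piece:
  assumes "x \<in> top_set"
  shows "rc (piece x)"
proof -
  obtain A where A: "x \<in> A" "A \<subseteq> hit (K x)" "rc A"
    using hit_piece[OF top_set_layer(2,4,3)[OF assms]] by blast
  have "A \<subseteq> piece x"
    using conn_subset_piece[OF _ A(2,1)] A(3) by (simp add: rc_def)
  moreover have "piece x \<subseteq> V"
    using piece_subset_hit[OF assms] hit_K_subset_top_set[OF assms] tower_subset_V[OF tower_top_set] by blast
  moreover have "conn E (piece x)"
    unfolding piece_def by (rule conn_component[OF symp_E])
  ultimately show ?thesis
    using A(3) unfolding rc_def by blast
qed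

lemma countable_piece: "x \<in> top_set \<Longrightarrow> countable (piece x)"
  using piece_subset_hit countable_hit[OF top_set_layer(2,4)] countable_subset by blast

text \<open>Only those rooted components of the next remainder are recorded that attach to
  \<open>hit (K x)\<close> infinitely often; \<open>no_barricade\<close> makes them countable in
  number.\<close>

definition children :: "'a \<Rightarrow> 'a set set" where
  "children x = {C. infinite (nb E (hit (K x)) C) \<and> C \<inter> U \<noteq> {} \<and>
    (\<exists>z\<in>V - step (pre x). C = cmp (step (pre x)) z)}"

lemma countable_children:
  assumes "x \<in> top_set"
  shows "countable (children x)"
proof (rule no_barricade[of "hit (K x)"])
  show "countable (hit (K x))"
    using countable_hit[OF top_set_layer(2,4)[OF assms]] .
  show "rc A" if "A \<in> children x" for A
    using that rc_cmp by (auto simp: children_def)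
  show "A \<inter> B = {}" if AB: "A \<in> children x" "B \<in> children x" "A \<noteq> B" for A B
  proof -
    obtain a b where ab: "A = cmp (step (pre x)) a" "B = cmp (step (pre x)) b"
      using AB by (auto simp: children_def)
    show ?thesis
      using cmp_eq[of _ "step (pre x)" a] cmp_eq[of _ "step (pre x)" b] AB(3) unfolding ab by blast
  qed
  show "A \<inter> hit (K x) = {}" if A: "A \<in> children x" for A
    using A cmp_subset hit_subset_step_pre[OF assms] unfolding children_def by blast
  show "infinite (nb E (hit (K x)) A)" if "A \<in> children x" for A
    using that by (simp add: children_def)
qed

text \<open>Each term serves a step of \<open>finite_adhesion_if_closed\<close>. The boundary of
  \<open>K x\<close> traps a connected set attached to \<open>x\<close> inside \<open>K x\<close>,
  and \<open>hit (K x)\<close> pushes it beyond that stage. The hitting sets of children treat a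
  last stage, the preceding pieces a limit of stages. For \<open>x\<close> outside
  \<open>top_set\<close> the boundary would trap a rooted set where there are no roots.\<close>

definition close :: "('a set \<Rightarrow> 'a set set) \<Rightarrow> 'a \<Rightarrow> 'a set" where
  "close f x = (if x \<in> top_set then hit (K x) \<union> bd E (K x) \<union> \<Union>(f (piece x)) \<union> \<Union>(hit ` children x)
     else if x \<in> V then bd E (cmp top_set x) else {})"

lemma countable_close:
  assumes f: "finite_back_degree (piece ` top_set) f"
  shows "countable (close f x)"
proof (cases "x \<in> top_set")
  case True
  have "countable (\<Union>(f (piece x)))"
  proof -
    have "finite (f (piece x))" "f (piece x) \<subseteq> piece ` top_set"
      using finite_back_degreeD(1,2)[OF f] True by auto
    then show ?thesis
      using countable_piece countable_UN[of "f (piece x)" "\<lambda>A. A"] by (auto intro: countable_finite)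
  qed
  moreover have "countable (\<Union>(hit ` children x))"
  proof (rule countable_UN[OF countable_children[OF True]])
    fix C assume "C \<in> children x"
    then obtain z where z: "z \<in> V - step (pre x)" "C = cmp (step (pre x)) z" "C \<inter> U \<noteq> {}"
      by (auto simp: children_def)
    then show "countable (hit C)"
      using countable_hit[OF rc_cmp countable_bd_cmp[OF tower_step[OF tower_pre]]] by blast
  qed
  ultimately show ?thesis
    using True countable_hit[OF top_set_layer(2,4)[OF True]] top_set_layer(4)[OF True]
    by (simp add: close_def)
next
  case False
  then show ?thesis
    using countable_bd_cmp[OF tower_top_set, of x] by (simp add: close_def)
qed

text \<open>If \<open>C\<close> had infinitely many neighbours \<open>S\<close> in \<open>Z\<close>,
  it would lie in \<open>K c\<close> and avoid \<open>step (pre c)\<close> for all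
  \<open>c \<in> S\<close>. Both with and without a last stage \<open>pre c\<close>, the component
  around \<open>C\<close> beyond these stages then has a hitting set that contradicts the closedness
  of \<open>Z\<close>.\<close>

lemma finite_adhesion_if_closed:
  assumes f: "finite_back_degree (piece ` top_set) f"
    and C: "rc C" "Z \<inter> C = {}" and closed: "\<And>z. z \<in> Z \<Longrightarrow> close f z \<subseteq> Z"
  shows "finite (nb E Z C)"
proof (rule ccontr)
  define S where "S = nb E Z C"
  assume "infinite (nb E Z C)"
  then have inf: "infinite S"
    by (simp add: S_def)
  have SZ: "S \<subseteq> Z"
    by (auto simp: S_def nb_def)
  have conn_C: "conn E C" and CV: "C \<subseteq> V"
    using C(1) by (auto simp: rc_def)
  obtain u where u: "u \<in> C" "u \<in> U"
    using C(1) by (auto simp: rc_def)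
  \<comment> \<open>\<open>C\<close> together with its neighbour \<open>c\<close> is connected,
    starts in \<open>Q\<close> at \<open>c\<close> and cannot pass the boundary of \<open>Q\<close>,
    which lies in \<open>Z\<close>.\<close>
  have absorb: "C \<subseteq> Q" if c: "c \<in> S" "c \<in> Q" and bd: "bd E Q \<subseteq> Z" for c Q
  proof -
    obtain a where a: "a \<in> C" "E a c"
      using c(1) by (auto simp: S_def nb_def)
    have "conn E (C \<union> {c})"
      using conn_Un[OF symp_E conn_C conn_singleton a(1)] a(2) by blast
    moreover have "(C \<union> {c}) \<inter> bd E Q = {}"
      using bd C(2) c(2) by (auto simp: nb_def)
    ultimately show ?thesis
      using conn_subset_if_avoids_bd[of E "C \<union> {c}" Q] c(2) by blast
  qed
  have S_top: "S \<subseteq> top_set"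
  proof
    fix c assume c: "c \<in> S"
    show "c \<in> top_set"
    proof (rule ccontr)
      assume nt: "c \<notin> top_set"
      have cV: "c \<in> V"
        using c nb_subset_V by (auto simp: S_def)
      then have "bd E (cmp top_set c) \<subseteq> Z"
        using closed[of c] c SZ nt by (auto simp: close_def)
      then have "C \<subseteq> cmp top_set c"
        using absorb[OF c component_self] by blast
      then show False
        using cmp_subset[of c top_set] cV nt u U_subset_top_set by blast
    qed
  qed
  have closed_top: "hit (K z) \<subseteq> Z" "bd E (K z) \<subseteq> Z" "\<Union>(f (piece z)) \<subseteq> Z" "\<Union>(hit ` children z) \<subseteq> Z"
    if z: "z \<in> Z" "z \<in> top_set" for z
    using closed[OF z(1)] z(2) by (auto simp: close_def)
  have CK: "C \<subseteq> K c" "C \<inter> hit (K c) = {}" "C \<inter> step (pre c) = {}" if c: "c \<in> S" for c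
  proof -
    have ct: "c \<in> top_set" and cZ: "c \<in> Z"
      using c S_top SZ by auto
    show 1: "C \<subseteq> K c"
      using absorb[OF c component_self closed_top(2)[OF cZ ct]] .
    show 2: "C \<inter> hit (K c) = {}"
      using closed_top(1)[OF cZ ct] C(2) by blast
    show "C \<inter> step (pre c) = {}"
      using 1 2 top_set_layer(5)[OF ct] by blast
  qed
  show False
  proof (cases "\<exists>c0\<in>S. \<forall>c\<in>S. pre c \<subseteq> pre c0")
    case True
    then obtain c0 where c0: "c0 \<in> S" "\<And>c. c \<in> S \<Longrightarrow> pre c \<subseteq> pre c0"
      by blast
    have c0t: "c0 \<in> top_set" and c0Z: "c0 \<in> Z"
      using c0 S_top SZ by auto
    let ?X = "step (pre c0)"
    let ?K' = "cmp ?X u"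
    have uX: "u \<in> V - ?X"
      using CK(3)[OF c0(1)] u CV by blast
    have SX: "S \<subseteq> ?X"
    proof
      fix c assume c: "c \<in> S"
      have "step (pre c) \<subseteq> ?X"
        using step_subset_if_psubset[OF tower_pre tower_pre, of c c0] c0(2)[OF c] subset_step[of "pre c0"]
        by (cases "pre c = pre c0") auto
      then show "c \<in> ?X"
        using in_step_pre c S_top by blast
    qed
    have CK': "C \<subseteq> ?K'"
      using conn_subset_cmp[OF conn_C _ u(1)] CV CK(3)[OF c0(1)] by blast
    have ne: "?K' \<inter> U \<noteq> {}"
      using u component_self[of u E "V - ?X"] by blast
    have bdK': "S \<subseteq> nb E (bd E ?K') C"
      using SX CK' cmp_subset[OF uX] by (auto simp: S_def nb_def)
    \<comment> \<open>At the last stage, neighbours inside \<open>K c0\<close> belong to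
      \<open>hit (K c0)\<close> and those outside to its boundary. The latter are finitely many, so
      \<open>?K'\<close> is a child of \<open>c0\<close>.\<close>
    have "S \<subseteq> nb E (bd E (K c0)) C \<union> nb E (hit (K c0)) C"
    proof
      fix s assume s: "s \<in> S"
      then obtain a where "a \<in> C" "E a s"
        by (auto simp: S_def nb_def)
      then show "s \<in> nb E (bd E (K c0)) C \<union> nb E (hit (K c0)) C"
        using CK(1)[OF c0(1)] top_set_layer(5)[OF c0t] SX s by (cases "s \<in> K c0") (auto simp: nb_def)
    qed
    moreover have "finite (nb E (bd E (K c0)) C)"
      using finite_nb_if_avoids_hit[OF top_set_layer(2,4)[OF c0t] C(1) CK(1,2)[OF c0(1)]] .
    ultimately have "infinite (nb E (hit (K c0)) C)"
      using inf by (meson finite_Un finite_subset)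
    then have "infinite (nb E (hit (K c0)) ?K')"
      using nb_mono[OF order_refl CK', of E "hit (K c0)"] finite_subset by blast
    then have "?K' \<in> children c0"
      using ne uX by (auto simp: children_def)
    then have "hit ?K' \<subseteq> Z"
      using closed_top(4)[OF c0Z c0t] by blast
    then have "C \<inter> hit ?K' = {}"
      using C(2) by blast
    then have "finite (nb E (bd E ?K') C)"
      using finite_nb_if_avoids_hit[OF rc_cmp[OF uX ne] countable_bd_cmp[OF tower_step[OF tower_pre] uX] C(1) CK']
      by blast
    then show False
      using bdK' inf finite_subset by blast
  next
    case False
    have up: "\<exists>c\<in>S. step (pre c0) \<subseteq> pre c" if "c0 \<in> S" for c0
      using False that tower_linear[OF tower_pre tower_pre] by blast
    \<comment> \<open>Without a last stage, every \<open>c \<in> S\<close> is removed before some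
      \<open>pre c'\<close> with \<open>c' \<in> S\<close>; hence \<open>S\<close> lies in the limit
      \<open>X\<close>, while \<open>C\<close> avoids it.\<close>
    define X where "X = \<Union>(pre ` S)"
    let ?K' = "cmp X u"
    have towX: "tower X"
      unfolding X_def by (rule tower_Union) (auto simp: tower_pre)
    have CX: "C \<subseteq> V - X"
    proof -
      have "C \<inter> pre c = {}" if "c \<in> S" for c
        using CK(3)[OF that] subset_step[of "pre c"] by blast
      then show ?thesis
        using CV by (auto simp: X_def)
    qed
    then have uX: "u \<in> V - X"
      using u by blast
    have SX: "S \<subseteq> X"
    proof
      fix c assume c: "c \<in> S"
      then obtain c' where "c' \<in> S" "step (pre c) \<subseteq> pre c'"
        using up by blast
      then show "c \<in> X"
        using in_step_pre[of c] c S_top by (auto simp: X_def)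
    qed
    have CK': "C \<subseteq> ?K'"
      using conn_subset_cmp[OF conn_C CX u(1)] .
    have ne: "?K' \<inter> U \<noteq> {}"
      using u component_self[of u E "V - X"] by blast
    note rcK' = rc_cmp[OF uX ne] and cK' = countable_bd_cmp[OF towX uX]
    have K'X: "?K' \<subseteq> V - X"
      using cmp_subset[OF uX] .
    have "S \<subseteq> nb E (bd E ?K') C"
      using SX CK' K'X by (auto simp: S_def nb_def)
    then have "infinite (nb E (bd E ?K') C)"
      using inf finite_subset by blast
    then obtain A where A: "rc A" "A \<subseteq> hit ?K'" "infinite (nb E (bd E ?K') A)" "A \<inter> C \<noteq> {}"
      using hit_meets[OF rcK' cK' C(1) CK'] by blast
    then obtain d where d: "d \<in> A" "d \<in> C"
      by blast
    have AK': "A \<subseteq> ?K'"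
      using A(2) hit_subset[OF rcK' cK'] by blast
    have dh: "d \<in> hit ?K'"
      using d A(2) by blast
    have dt: "d \<in> top_set"
      using dh hit_subset_top_set[OF towX uX ne] by blast
    have Kd: "K d = ?K'"
      using layer_eq(2)[OF towX uX ne dh] .
    have Ad: "A \<subseteq> piece d"
      using conn_subset_piece[of A d] A(1,2) d(1) unfolding Kd rc_def by blast
    have K'K: "?K' \<subseteq> K c" if c: "c \<in> S" for c
    proof -
      have "?K' \<subseteq> cmp (pre c) u"
        using cmp_antimono[OF _ uX, of "pre c"] c by (auto simp: X_def)
      moreover have "cmp (pre c) u = K c"
        using cmp_eq[of u "pre c" c] CK(1)[OF c] u(1) by blast
      ultimately show ?thesis
        by simp
    qed
    have bdZ: "bd E ?K' \<subseteq> Z"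
    proof
      fix n assume n: "n \<in> bd E ?K'"
      then obtain c where c: "c \<in> S" "n \<in> pre c"
        using bd_cmp_subset[OF uX] by (auto simp: X_def)
      then have ct: "c \<in> top_set" and cZ: "c \<in> Z"
        using S_top SZ by auto
      have "n \<in> bd E (K c)"
        using n K'K[OF c(1)] c(2) cmp_subset[OF top_set_layer(1)[OF ct]] by (auto simp: nb_def)
      then show "n \<in> Z"
        using closed_top(2)[OF cZ ct] by blast
    qed
    have dZ: "d \<notin> Z"
      using d(2) C(2) by blast
    define N where "N = nb E (bd E ?K') A"
    have N_bd: "N \<subseteq> bd E ?K'"
      by (auto simp: N_def nb_def)
    have NX: "N \<subseteq> X"
      using N_bd bd_cmp_subset[OF uX] by blast
    have NZ: "N \<subseteq> Z"
      using N_bd bdZ by blast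
    have N_top: "N \<subseteq> top_set"
      using NX tower_subset_top_set[OF towX] by blast
    \<comment> \<open>The two pieces are adjacent. If \<open>piece n\<close> listed
      \<open>piece d\<close>, closedness of \<open>Z\<close> at \<open>n\<close> would put
      \<open>d\<close> into \<open>Z\<close>; so the list of \<open>piece d\<close> contains
      \<open>piece n\<close>.\<close>
    have "piece n \<in> f (piece d)" if n: "n \<in> N" for n
    proof -
      have nt: "n \<in> top_set"
        using n N_top by blast
      have "n \<notin> piece d"
        using n NX piece_subset_hit[OF dt] hit_subset[OF rcK' cK'] K'X unfolding Kd by blast
      then have neq: "piece d \<noteq> piece n"
        using piece_self[of n] by blast
      obtain a where "a \<in> A" "E a n"
        using n by (auto simp: N_def nb_def)
      then have "piece n \<in> f (piece d) \<or> piece d \<in> f (piece n)"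
        using finite_back_degreeD(3)[OF f, of "piece d" "piece n" a n] dt nt neq Ad piece_self[of n] by blast
      moreover have "piece d \<notin> f (piece n)"
        using closed_top(3)[of n] n NZ nt dZ piece_self[of d] by blast
      ultimately show ?thesis
        by blast
    qed
    then have "piece ` N \<subseteq> f (piece d)"
      by blast
    then have "finite (piece ` N)"
      using finite_back_degreeD(1)[OF f, of "piece d"] dt finite_subset by blast
    moreover have "infinite N"
      using A(3) by (simp add: N_def)
    \<comment> \<open>Finitely many pieces cover the infinitely many vertices of \<open>N\<close>,
      so one of them contains infinitely many.\<close>
    ultimately obtain n0 where n0: "n0 \<in> N" "infinite {n \<in> N. piece n = piece n0}"
      using pigeonhole_infinite[of N piece] by blast
    have n0t: "n0 \<in> top_set"
      using n0(1) N_top by blast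
    obtain c where c: "c \<in> S" "n0 \<in> pre c"
      using n0(1) NX by (auto simp: X_def)
    have ct: "c \<in> top_set"
      using c S_top by blast
    have "piece n0 \<subseteq> pre c"
      using piece_subset_hit[OF n0t] hit_subset_step_pre[OF n0t] step_pre_subset[OF tower_pre c(2)] by blast
    then have "n \<in> pre c" if "piece n = piece n0" for n
      using that piece_self[of n] by blast
    moreover have "N \<inter> pre c \<subseteq> nb E (bd E (K c)) A"
      using AK' K'K[OF c(1)] cmp_subset[OF top_set_layer(1)[OF ct]] by (auto simp: N_def nb_def)
    ultimately have "{n \<in> N. piece n = piece n0} \<subseteq> nb E (bd E (K c)) A"
      by blast
    \<comment> \<open>The popular piece lies inside the single stage \<open>pre c\<close>. Since
      \<open>A\<close> belongs to the later limit stage, it avoids \<open>hit (K c)\<close> and has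
      only finitely many neighbours in the boundary of \<open>K c\<close>.\<close>
    moreover have "finite (nb E (bd E (K c)) A)"
    proof (rule finite_nb_if_avoids_hit[OF top_set_layer(2,4)[OF ct] A(1)])
      show "A \<subseteq> K c"
        using AK' K'K[OF c(1)] by blast
      obtain c' where c': "c' \<in> S" "step (pre c) \<subseteq> pre c'"
        using up c(1) by blast
      have "hit (K c) \<subseteq> X"
        using hit_subset_step_pre[OF ct] c' by (auto simp: X_def)
      then show "A \<inter> hit (K c) = {}"
        using AK' K'X by blast
    qed
    ultimately show False
      using n0(2) finite_subset by blast
  qed
qed

lemma countable_rtrancl_Image:
  assumes "\<And>x. countable (F x)"
  shows "countable {y. (x, y) \<in> {(a, b). b \<in> F a}\<^sup>*}"
proof -
  let ?R = "{(a, b). b \<in> F a}"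
  have "countable ((?R ^^ n) `` {x})" for n
  proof (induction n)
    case (Suc n)
    have "(?R ^^ Suc n) `` {x} = (\<Union>a\<in>(?R ^^ n) `` {x}. F a)"
      by (auto simp: relcomp_unfold)
    then show ?case
      using countable_UN[OF Suc, of F] assms by (simp del: relpow.simps)
  qed simp
  then have "countable (\<Union>n. (?R ^^ n) `` {x})"
    by blast
  moreover have "{y. (x, y) \<in> ?R\<^sup>*} = (\<Union>n. (?R ^^ n) `` {x})"
    by (auto simp: rtrancl_power)
  ultimately show ?thesis
    by simp
qed

text \<open>\<open>F x\<close> collects what is reachable from \<open>x\<close> by iterating
  \<open>close f\<close>. \<open>Y\<close> itself may be far from closed: only the closures of its
  elements have to miss \<open>C\<close>, which is what growing a tree requires.\<close>

lemma closure_operator: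
  "\<exists>F. (\<forall>x. countable (F x)) \<and> (\<forall>Y C. rc C \<longrightarrow> (\<forall>y\<in>Y. F y \<inter> C = {}) \<longrightarrow> finite (nb E Y C))"
proof -
  have "\<exists>f. finite_back_degree (piece ` top_set) f"
  proof (rule minor_orientation)
    show "rc X" if "X \<in> piece ` top_set" for X
      using that rc_piece by blast
    show "X \<inter> Y = {}" if XY: "X \<in> piece ` top_set" "Y \<in> piece ` top_set" "X \<noteq> Y" for X Y
    proof (rule ccontr)
      assume "X \<inter> Y \<noteq> {}"
      then obtain z where z: "z \<in> X" "z \<in> Y"
        by blast
      obtain x y where "x \<in> top_set" "X = piece x" "y \<in> top_set" "Y = piece y"
        using XY(1,2) by blast
      then show False
        using piece_eq[of x z] piece_eq[of y z] z XY(3) by simp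
    qed
  qed
  then obtain f where f: "finite_back_degree (piece ` top_set) f"
    by blast
  define F where "F x = {y. (x, y) \<in> {(a, b). b \<in> close f a}\<^sup>*}" for x
  have "finite (nb E Y C)" if C: "rc C" "\<forall>y\<in>Y. F y \<inter> C = {}" for Y C
  proof -
    have "finite (nb E (\<Union>(F ` Y)) C)"
    proof (rule finite_adhesion_if_closed[OF f C(1)])
      show "\<Union>(F ` Y) \<inter> C = {}"
        using C(2) by blast
      show "close f z \<subseteq> \<Union>(F ` Y)" if z: "z \<in> \<Union>(F ` Y)" for z
        using z by (auto simp: F_def intro: rtrancl.rtrancl_into_rtrancl)
    qed
    moreover have "Y \<subseteq> \<Union>(F ` Y)"
      by (auto simp: F_def)
    ultimately show ?thesis
      using nb_mono[of Y "\<Union>(F ` Y)" C C E] finite_subset by blast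
  qed
  moreover have "countable (F x)" for x
    using countable_rtrancl_Image[of "close f" x] countable_close[OF f] by (simp add: F_def)
  ultimately show ?thesis
    by blast
qed

end

section \<open>Growing normal trees\<close>

text \<open>A tree with root \<open>r\<close> is encoded by the set \<open>P\<close> of its pairs (child, parent), so that
  \<open>(y, x) \<in> P\<^sup>*\<close> says that \<open>x\<close> lies below \<open>y\<close> in the tree order, and \<open>P \<subseteq> P'\<close> says that
  \<open>P'\<close> is an end-extension of \<open>P\<close>.\<close>

definition tv :: "'a \<Rightarrow> ('a \<times> 'a) set \<Rightarrow> 'a set" where
  "tv r P = insert r (Domain P)"

definition ptree :: "'a \<Rightarrow> ('a \<times> 'a) set \<Rightarrow> bool" where
  "ptree r P \<longleftrightarrow> single_valued P \<and> r \<notin> Domain P \<and> (\<forall>y\<in>tv r P. (y, r) \<in> P\<^sup>*)"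

definition ht :: "('a \<times> 'a) set \<Rightarrow> 'a \<Rightarrow> nat" where
  "ht P y = card {x. (y, x) \<in> P\<^sup>*}"

lemma tv_mono: "P \<subseteq> Q \<Longrightarrow> tv r P \<subseteq> tv r Q"
  by (auto simp: tv_def)

text \<open>Both \<open>z\<close> and \<open>r\<close> lie on the unique chain of parents of
  \<open>y\<close>, and this chain ends in \<open>r\<close>.\<close>

lemma ptree_tree_order_closed:
  assumes "ptree r P" "(y, z) \<in> P\<^sup>*" "y \<in> tv r P"
  shows "z \<in> tv r P"
proof -
  have "(y, r) \<in> P\<^sup>*"
    using assms by (auto simp: ptree_def)
  then have "(z, r) \<in> P\<^sup>* \<or> (r, z) \<in> P\<^sup>*"
    using single_valued_confluent[OF _ assms(2)] assms(1) by (auto simp: ptree_def)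
  then show ?thesis
    using assms(1) by (auto simp: ptree_def tv_def elim: converse_rtranclE)
qed

text \<open>The chain of parents of a vertex on a cycle stays on the cycle; as it reaches
  \<open>r\<close>, the root would have a parent.\<close>

lemma ptree_acyclic:
  assumes P: "ptree r P"
  shows "(x, x) \<notin> P\<^sup>+"
proof
  assume x: "(x, x) \<in> P\<^sup>+"
  then have "x \<in> Domain P"
    by (metis Domain.DomainI converse_tranclE)
  then have "(x, r) \<in> P\<^sup>*"
    using P by (auto simp: ptree_def tv_def)
  then have "(r, x) \<in> P\<^sup>+"
  proof (induction rule: rtrancl_induct)
    case (step y z)
    obtain w where w: "(y, w) \<in> P" "(w, x) \<in> P\<^sup>*"
      using step.IH by (meson tranclD)
    then have "w = z"
      using step.hyps(2) P by (auto simp: ptree_def single_valued_def)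
    then show ?case
      using w(2) x by (metis rtranclD)
  qed (rule x)
  then have "r \<in> Domain P"
    by (metis Domain.DomainI converse_tranclE)
  then show False
    using P by (simp add: ptree_def)
qed

lemma ptree_antisym:
  assumes "ptree r P" "(x, y) \<in> P\<^sup>*" "(y, x) \<in> P\<^sup>*"
  shows "x = y"
  using ptree_acyclic[OF assms(1)] assms(2,3) by (metis rtranclD trancl_rtrancl_trancl)

lemma ptree_finite_down:
  assumes P: "ptree r P" and "y \<in> tv r P"
  shows "finite {x. (y, x) \<in> P\<^sup>*}"
proof -
  have "(y, r) \<in> P\<^sup>*"
    using assms by (auto simp: ptree_def)
  then show ?thesis
  proof (induction rule: converse_rtrancl_induct)
    case base
    have "{x. (r, x) \<in> P\<^sup>*} = {r}"
      using P by (auto simp: ptree_def elim: converse_rtranclE)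
    then show ?case
      by simp
  next
    case (step y z)
    have "{x. (y, x) \<in> P\<^sup>*} \<subseteq> insert y {x. (z, x) \<in> P\<^sup>*}"
    proof
      fix x assume "x \<in> {x. (y, x) \<in> P\<^sup>*}"
      then have "(y, x) \<in> P\<^sup>*"
        by simp
      then show "x \<in> insert y {x. (z, x) \<in> P\<^sup>*}"
        using step.hyps(1) P by (cases rule: converse_rtranclE) (auto simp: ptree_def single_valued_def)
    qed
    then show ?case
      using step.IH finite_subset by blast
  qed
qed

lemma ptree_ht_less:
  assumes P: "ptree r P" and "y \<in> tv r P" "(y, x) \<in> P\<^sup>*" "x \<noteq> y"
  shows "ht P x < ht P y"
  unfolding ht_def
proof (rule psubset_card_mono[OF ptree_finite_down[OF P assms(2)]])
  have "(x, y) \<notin> P\<^sup>*"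
    using ptree_antisym[OF P assms(3)] assms(4) by blast
  then show "{z. (x, z) \<in> P\<^sup>*} \<subset> {z. (y, z) \<in> P\<^sup>*}"
    using assms(3) rtrancl_trans by fastforce
qed

lemma ptree_Union:
  assumes "\<C> \<noteq> {}" and P: "\<And>P. P \<in> \<C> \<Longrightarrow> ptree r P"
    and chain: "\<And>P Q. P \<in> \<C> \<Longrightarrow> Q \<in> \<C> \<Longrightarrow> P \<subseteq> Q \<or> Q \<subseteq> P"
  shows "ptree r (\<Union>\<C>)" "tv r (\<Union>\<C>) = \<Union>(tv r ` \<C>)"
proof -
  show tv: "tv r (\<Union>\<C>) = \<Union>(tv r ` \<C>)"
    using assms(1) by (auto simp: tv_def)
  have "single_valued (\<Union>\<C>)"
    unfolding single_valued_def
  proof (intro allI impI)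
    fix x y z assume "(x, y) \<in> \<Union>\<C>" "(x, z) \<in> \<Union>\<C>"
    then obtain P Q where PQ: "P \<in> \<C>" "Q \<in> \<C>" "(x, y) \<in> P" "(x, z) \<in> Q"
      by blast
    then obtain R where "R \<in> \<C>" "(x, y) \<in> R" "(x, z) \<in> R"
      using chain[of P Q] by blast
    then show "y = z"
      using P[of R] by (auto simp: ptree_def single_valued_def)
  qed
  moreover have "r \<notin> Domain (\<Union>\<C>)"
    using P by (auto simp: ptree_def)
  moreover have "(y, r) \<in> (\<Union>\<C>)\<^sup>*" if "y \<in> tv r (\<Union>\<C>)" for y
  proof -
    obtain P' where P': "P' \<in> \<C>" "y \<in> tv r P'"
      using \<open>y \<in> tv r (\<Union>\<C>)\<close> tv by auto
    then have "(y, r) \<in> P'\<^sup>*"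
      using P[OF P'(1)] by (auto simp: ptree_def)
    then show ?thesis
      using rtrancl_mono[of P' "\<Union>\<C>"] P'(1) by blast
  qed
  ultimately show "ptree r (\<Union>\<C>)"
    by (simp add: ptree_def)
qed

lemma ptree_insert_leaf:
  assumes P: "ptree r P" and t: "t \<in> tv r P" and c: "c \<notin> tv r P"
  shows "ptree r (insert (c, t) P)" "tv r (insert (c, t) P) = insert c (tv r P)"
proof -
  let ?P = "insert (c, t) P"
  show tv: "tv r ?P = insert c (tv r P)"
    by (auto simp: tv_def)
  have mono: "P\<^sup>* \<subseteq> ?P\<^sup>*"
    by (rule rtrancl_mono) blast
  have old: "(y, r) \<in> ?P\<^sup>*" if "y \<in> tv r P" for y
    using P that mono by (auto simp: ptree_def)
  then have "(c, r) \<in> ?P\<^sup>*"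
    using t by (meson converse_rtrancl_into_rtrancl insertI1)
  then show "ptree r ?P"
    using P c old tv by (auto simp: ptree_def tv_def single_valued_def)
qed

section \<open>Normality expressed by linked vertices\<close>

context rooted_graph
begin

definition comparable :: "('a \<times> 'a) set \<Rightarrow> 'a \<Rightarrow> 'a \<Rightarrow> bool" where
  "comparable P x y \<longleftrightarrow> (x, y) \<in> P\<^sup>* \<or> (y, x) \<in> P\<^sup>*"

definition linked :: "'a set \<Rightarrow> 'a \<Rightarrow> 'a \<Rightarrow> bool" where
  "linked T x y \<longleftrightarrow> E x y \<or> (\<exists>C. conn E C \<and> C \<subseteq> V \<and> C \<inter> T = {} \<and> (\<exists>a\<in>C. E a x) \<and> (\<exists>b\<in>C. E b y))"

definition ntree :: "'a \<Rightarrow> ('a \<times> 'a) set \<Rightarrow> bool" where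
  "ntree r P \<longleftrightarrow> ptree r P \<and> (\<forall>(x, y)\<in>P. E x y) \<and>
    (\<forall>x\<in>tv r P. \<forall>y\<in>tv r P. linked (tv r P) x y \<longrightarrow> comparable P x y)"

lemma comparable_mono: "comparable P x y \<Longrightarrow> P \<subseteq> Q \<Longrightarrow> comparable Q x y"
  using rtrancl_mono[of P Q] by (auto simp: comparable_def)

lemma comparable_sym: "comparable P x y \<longleftrightarrow> comparable P y x"
  by (auto simp: comparable_def)

lemma linked_sym: "linked T x y \<longleftrightarrow> linked T y x"
  using E_sym unfolding linked_def by blast

lemma linked_antimono: "linked T x y \<Longrightarrow> S \<subseteq> T \<Longrightarrow> linked S x y"
  unfolding linked_def by blast

lemma ntree_tv_subset_V: "ntree r P \<Longrightarrow> r \<in> V \<Longrightarrow> tv r P \<subseteq> V"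
  using E_in_V by (auto simp: ntree_def tv_def)

lemma ntree_Union:
  assumes "\<C> \<noteq> {}" and P: "\<And>P. P \<in> \<C> \<Longrightarrow> ntree r P"
    and chain: "\<And>P Q. P \<in> \<C> \<Longrightarrow> Q \<in> \<C> \<Longrightarrow> P \<subseteq> Q \<or> Q \<subseteq> P"
  shows "ntree r (\<Union>\<C>)"
proof -
  have pt: "\<And>P. P \<in> \<C> \<Longrightarrow> ptree r P"
    using P by (simp add: ntree_def)
  note U = ptree_Union[OF assms(1) pt chain]
  have "comparable (\<Union>\<C>) x y"
    if xy: "x \<in> tv r (\<Union>\<C>)" "y \<in> tv r (\<Union>\<C>)" "linked (tv r (\<Union>\<C>)) x y" for x y
  proof -
    obtain P1 P2 where P12: "P1 \<in> \<C>" "x \<in> tv r P1" "P2 \<in> \<C>" "y \<in> tv r P2"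
      using xy U(2) by auto
    then obtain Q where Q: "Q \<in> \<C>" "x \<in> tv r Q" "y \<in> tv r Q"
      using chain[of P1 P2] tv_mono[of P1 P2 r] tv_mono[of P2 P1 r] by blast
    have "linked (tv r Q) x y"
      using linked_antimono[OF xy(3)] U(2) Q(1) by blast
    then have "comparable Q x y"
      using P[OF Q(1)] Q by (auto simp: ntree_def)
    then show ?thesis
      using comparable_mono Q(1) by blast
  qed
  moreover have "\<forall>(x, y)\<in>\<Union>\<C>. E x y"
    using P by (auto simp: ntree_def)
  ultimately show ?thesis
    using U(1) by (simp add: ntree_def)
qed

text \<open>Old vertices linked to the leaf \<open>c\<close> are neighbours of the component of
  \<open>c\<close>, hence lie below \<open>t\<close>. Old pairs acquire no new links when the tree
  grows.\<close>

lemma ntree_insert_leaf: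
  assumes P: "ntree r P" and t: "t \<in> tv r P" and c: "c \<notin> tv r P" "E c t"
    and above: "\<And>y. y \<in> nb E (tv r P) (component E (V - tv r P) c) \<Longrightarrow> (t, y) \<in> P\<^sup>*"
  shows "ntree r (insert (c, t) P)"
proof -
  let ?P = "insert (c, t) P" and ?T = "tv r P"
  let ?K = "component E (V - ?T) c"
  have pt: "ptree r P"
    using P by (simp add: ntree_def)
  note I = ptree_insert_leaf[OF pt t c(1)]
  have cV: "c \<in> V - ?T"
    using c E_in_V by blast
  have new: "comparable ?P c y" if y: "y \<in> ?T" "linked (insert c ?T) c y" for y
  proof -
    have "y \<in> nb E ?T ?K"
      using y(2) unfolding linked_def
    proof (elim disjE exE conjE bexE)
      assume "E c y"
      then show ?thesis
        using y(1) component_self[of c E "V - ?T"] by (auto simp: nb_def)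
    next
      fix C a b assume C: "conn E C" "C \<subseteq> V" "C \<inter> insert c ?T = {}" "a \<in> C" "E a c" "b \<in> C" "E b y"
      have "conn E (C \<union> {c})"
        using conn_Un[OF symp_E C(1) conn_singleton C(4)] C(5) by blast
      then have "C \<union> {c} \<subseteq> ?K"
        using C(2,3) cV component_self[of c E "V - ?T"] by (intro conn_subset_component[OF symp_E]) auto
      then show ?thesis
        using C(6,7) y(1) by (auto simp: nb_def)
    qed
    then have "(t, y) \<in> ?P\<^sup>*"
      using above rtrancl_mono[of P ?P] by blast
    then show ?thesis
      by (auto simp: comparable_def intro: converse_rtrancl_into_rtrancl)
  qed
  have "comparable ?P x y" if xy: "x \<in> insert c ?T" "y \<in> insert c ?T" "linked (insert c ?T) x y" for x y
  proof (cases "x = c")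
    case True
    then show ?thesis
      using new[of y] xy by (cases "y = c") (auto simp: comparable_def)
  next
    case xc: False
    show ?thesis
    proof (cases "y = c")
      case True
      then show ?thesis
        using new[of x] xy xc by (auto simp: comparable_sym[of _ x] linked_sym[of _ x])
    next
      case False
      then have "comparable P x y"
        using P xy xc linked_antimono[OF xy(3), of ?T] by (auto simp: ntree_def)
      then show ?thesis
        by (rule comparable_mono) blast
    qed
  qed
  then show ?thesis
    using P I c(2) by (auto simp: ntree_def)
qed

text \<open>After inserting \<open>c\<close>, the component of the next path vertex lies in the old
  component, so its neighbours in the tree are old ones, which lie below \<open>t\<close>, or
  \<open>c\<close> itself. Thus the last inserted vertex is above all of them and the insertion can
  be repeated.\<close>

lemma ntree_extend_along_path:
  assumes "ntree r P" "t \<in> tv r P" "successively E (t # cs)" "distinct cs" "set cs \<inter> tv r P = {}" "cs \<noteq> []"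
    and "\<And>y. y \<in> nb E (tv r P) (component E (V - tv r P) (hd cs)) \<Longrightarrow> (t, y) \<in> P\<^sup>*"
  shows "\<exists>P'. P \<subseteq> P' \<and> ntree r P' \<and> finite (tv r P' - tv r P) \<and> last cs \<in> tv r P'"
  using assms
proof (induction cs arbitrary: P t)
  case (Cons c cs)
  let ?P = "insert (c, t) P"
  have c: "c \<notin> tv r P" "E c t"
    using Cons.prems E_sym by auto
  have pt: "ptree r P"
    using Cons.prems(1) by (simp add: ntree_def)
  have nt: "ntree r ?P"
    using ntree_insert_leaf[OF Cons.prems(1,2) c] Cons.prems(7) by simp
  have tvP: "tv r ?P = insert c (tv r P)"
    using ptree_insert_leaf(2)[OF pt Cons.prems(2) c(1)] .
  show ?case
  proof (cases "cs = []")
    case True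
    then show ?thesis
      using nt tvP by (intro exI[of _ ?P]) (auto intro: finite_subset[of _ "{c}"])
  next
    case False
    have hd: "hd cs \<notin> tv r ?P" "E c (hd cs)" "hd cs \<in> V"
      using Cons.prems(3-5) False tvP hd_in_set[OF False] E_in_V(2)[of c "hd cs"]
      by (auto simp: successively_Cons disjoint_iff)
    have above: "(c, y) \<in> ?P\<^sup>*" if y: "y \<in> nb E (tv r ?P) (component E (V - tv r ?P) (hd cs))" for y
    proof (cases "y = c")
      case False
      have "component E (V - tv r ?P) (hd cs) \<subseteq> component E (V - tv r P) (hd cs)"
        unfolding component_def using edges_in_rtrancl_mono[of _ _ E "V - tv r ?P" "V - tv r P"] tvP by auto
      moreover have "(c, hd cs) \<in> edges_in E (V - tv r P)"
        using hd c tvP E_in_V by (auto simp: edges_in_def)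
      then have "component E (V - tv r P) (hd cs) = component E (V - tv r P) c"
        by (intro component_eq[OF symp_E]) (auto simp: component_def)
      ultimately have "y \<in> nb E (tv r P) (component E (V - tv r P) c)"
        using y False tvP by (auto simp: nb_def)
      then have "(t, y) \<in> ?P\<^sup>*"
        using Cons.prems(7) rtrancl_mono[of P ?P] by auto
      then show ?thesis
        by (meson converse_rtrancl_into_rtrancl insertI1)
    qed simp
    have "\<exists>P'. ?P \<subseteq> P' \<and> ntree r P' \<and> finite (tv r P' - tv r ?P) \<and> last cs \<in> tv r P'"
    proof (rule Cons.IH[OF nt])
      show "c \<in> tv r ?P"
        using tvP by simp
      show "successively E (c # cs)" "distinct cs" "set cs \<inter> tv r ?P = {}"
        using Cons.prems(3-5) tvP by auto
    qed (use False above in auto)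
    then obtain P' where P': "?P \<subseteq> P'" "ntree r P'" "finite (tv r P' - tv r ?P)" "last cs \<in> tv r P'"
      by blast
    have "finite (tv r P' - tv r P)"
      using P'(3) tvP by (auto intro: finite_subset[of _ "insert c (tv r P' - tv r ?P)"])
    then show ?thesis
      using P' False by (intro exI[of _ P']) auto
  qed
qed simp

end

section \<open>Extending a normal tree by countably many vertices\<close>

locale tree_growth = rooted_graph +
  fixes r :: 'a and F :: "'a \<Rightarrow> 'a set"
  assumes root: "r \<in> V"
    and countable_F: "countable (F x)"
    and finite_adhesion: "rc C \<Longrightarrow> (\<And>y. y \<in> Y \<Longrightarrow> F y \<inter> C = {}) \<Longrightarrow> finite (nb E Y C)"
begin

text \<open>A vertex of \<open>shed P\<close> either belongs to the tree or is irrelevant for all of its further extensions.\<close>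
definition shed :: "('a \<times> 'a) set \<Rightarrow> 'a set" where
  "shed P = {q. \<forall>C. rc C \<longrightarrow> C \<inter> tv r P = {} \<longrightarrow> q \<notin> C}"

lemma shed_mono: "P \<subseteq> Q \<Longrightarrow> shed P \<subseteq> shed Q"
  using tv_mono[of P Q r] by (auto simp: shed_def) blast

text \<open>By finite adhesion to \<open>B\<close> and finiteness of the rest, the component
  \<open>?K\<close> of an unabsorbed \<open>q\<close> has finitely many neighbours in the tree. They
  are pairwise linked through \<open>?K\<close>, hence form a chain, and a path in \<open>?K\<close>
  to \<open>q\<close> is attached above the highest one.\<close>

lemma absorb_vertex:
  assumes P: "ntree r P" and B: "\<And>x. x \<in> B \<Longrightarrow> F x \<subseteq> shed P" and fin: "finite (tv r P - B)"
  shows "\<exists>P'. P \<subseteq> P' \<and> ntree r P' \<and> finite (tv r P' - B) \<and> q \<in> shed P'"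
proof (cases "q \<in> shed P")
  case False
  let ?T = "tv r P"
  let ?K = "component E (V - ?T) q"
  obtain C where C: "rc C" "C \<inter> ?T = {}" "q \<in> C"
    using False by (auto simp: shed_def)
  have CV: "C \<subseteq> V - ?T"
    using C by (auto simp: rc_def)
  then have qV: "q \<in> V - ?T"
    using C(3) by blast
  have rcK: "rc ?K"
    using rc_component[OF C(1) CV _ C(3)] by blast
  have KT: "?K \<subseteq> V - ?T"
    using component_subset[OF qV] .
  have "F y \<inter> ?K = {}" if "y \<in> B" for y
    using B[OF that] rcK KT by (auto simp: shed_def)
  then have "finite (nb E B ?K)"
    by (rule finite_adhesion[OF rcK])
  moreover have "nb E ?T ?K \<subseteq> nb E B ?K \<union> (?T - B)"
    by (auto simp: nb_def)
  ultimately have finN: "finite (nb E ?T ?K)"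
    using fin by (meson finite_UnI finite_subset)
  \<comment> \<open>All boundary vertices of \<open>?K\<close> lie in the tree; without any,
    \<open>?K\<close> would be all of the connected graph and contain the root.\<close>
  have "nb E ?T ?K \<noteq> {}"
  proof
    assume no: "nb E ?T ?K = {}"
    have "bd E ?K \<subseteq> nb E ?T ?K"
      using bd_component_disjoint[OF qV, of E] E_in_V by (auto simp: nb_def)
    then have "V \<subseteq> ?K"
      using no qV component_self[of q E "V - ?T"] by (intro conn_subset_if_avoids_bd[OF conn_V]) auto
    then show False
      using root KT by (auto simp: tv_def)
  qed
  then have "Max (ht P ` nb E ?T ?K) \<in> ht P ` nb E ?T ?K"
    using finN by (intro Max_in) auto
  then obtain t where "t \<in> nb E ?T ?K" "ht P t = Max (ht P ` nb E ?T ?K)"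
    by auto
  then have t: "t \<in> nb E ?T ?K" "\<And>y. y \<in> nb E ?T ?K \<Longrightarrow> ht P y \<le> ht P t"
    using finN by auto
  have top: "(t, y) \<in> P\<^sup>*" if y: "y \<in> nb E ?T ?K" for y
  proof -
    have pt: "ptree r P"
      using P by (simp add: ntree_def)
    have tT: "t \<in> ?T" "y \<in> ?T"
      using t y by (auto simp: nb_def)
    have "linked ?T t y"
      using t(1) y KT rcK unfolding linked_def rc_def nb_def by blast
    then have "comparable P t y"
      using P tT by (auto simp: ntree_def)
    then show ?thesis
      using ptree_ht_less[OF pt tT(2), of t] t(2)[OF y] by (auto simp: comparable_def)
  qed
  obtain c where c: "c \<in> ?K" "E c t"
    using t(1) by (auto simp: nb_def)
  have Kc: "component E (V - ?T) c = ?K"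
    using component_eq[OF symp_E c(1)] .
  have "(c, q) \<in> (edges_in E ?K)\<^sup>*"
    using rcK c(1) component_self[of q E "V - ?T"] by (auto simp: rc_def conn_def)
  then obtain cs where cs: "is_path E cs" "set cs \<subseteq> ?K" "hd cs = c" "last cs = q"
    using rtrancl_edges_in_path c(1) by metis
  have "\<exists>P'. P \<subseteq> P' \<and> ntree r P' \<and> finite (tv r P' - ?T) \<and> last cs \<in> tv r P'"
  proof (rule ntree_extend_along_path[OF P, of t cs])
    show "t \<in> ?T"
      using t(1) by (auto simp: nb_def)
    show "successively E (t # cs)" "distinct cs" "cs \<noteq> []"
      using cs c(2) E_sym by (auto simp: is_path_successively successively_Cons)
    show "set cs \<inter> ?T = {}"
      using cs(2) KT by blast
    show "(t, y) \<in> P\<^sup>*" if "y \<in> nb E ?T (component E (V - ?T) (hd cs))" for y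
      using that top cs(3) Kc by simp
  qed
  then obtain P' where P': "P \<subseteq> P'" "ntree r P'" "finite (tv r P' - ?T)" "q \<in> tv r P'"
    using cs(4) by blast
  have "finite (tv r P' - B)"
    using P'(3) fin by (auto intro: finite_subset[of _ "(tv r P' - ?T) \<union> (?T - B)"])
  moreover have "q \<in> shed P'"
    using P'(4) by (auto simp: shed_def)
  ultimately show ?thesis
    using P' by blast
qed (use assms in blast)

lemma absorb_finite:
  assumes "finite Q" and P: "ntree r P" and B: "\<And>x. x \<in> B \<Longrightarrow> F x \<subseteq> shed P" and fin: "finite (tv r P - B)"
  shows "\<exists>P'. P \<subseteq> P' \<and> ntree r P' \<and> finite (tv r P' - B) \<and> Q \<subseteq> shed P'"
  using assms(1)
proof (induction Q rule: finite_induct)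
  case empty
  then show ?case
    using P fin by blast
next
  case (insert q Q)
  then obtain P1 where P1: "P \<subseteq> P1" "ntree r P1" "finite (tv r P1 - B)" "Q \<subseteq> shed P1"
    by blast
  then obtain P2 where P2: "P1 \<subseteq> P2" "ntree r P2" "finite (tv r P2 - B)" "q \<in> shed P2"
    using absorb_vertex[of P1 B q] B shed_mono[OF P1(1)] by (meson order_trans)
  then show ?case
    using P1 shed_mono[OF P2(1)] by (intro exI[of _ P2]) auto
qed

text \<open>Dovetailing: round \<open>n\<close> absorbs the first \<open>n + 1\<close> elements of
  \<open>F x\<close> for each of the finitely many tree vertices \<open>x\<close> outside
  \<open>B\<close>. Every round adds finitely many vertices, and in the union nothing is left
  out.\<close>

lemma absorb_closed:
  assumes "finite Q" and P: "ntree r P" and B: "\<And>x. x \<in> B \<Longrightarrow> F x \<subseteq> shed P" and fin: "finite (tv r P - B)"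
  shows "\<exists>P'. P \<subseteq> P' \<and> ntree r P' \<and> (\<forall>x\<in>tv r P'. F x \<subseteq> shed P') \<and> Q \<subseteq> shed P'"
proof -
  define ok where "ok P' \<longleftrightarrow> P \<subseteq> P' \<and> ntree r P' \<and> finite (tv r P' - B) \<and> Q \<subseteq> shed P'" for P'
  \<comment> \<open>For empty \<open>F x\<close> the enumeration yields an arbitrary value, and any
    value can be absorbed.\<close>
  define enum where "enum n P' = (\<Union>x\<in>tv r P' - B. from_nat_into (F x) ` {..n})" for n :: nat and P'
  have ok_B: "F x \<subseteq> shed P'" if "ok P'" "x \<in> B" for P' x
    using that B shed_mono[of P P'] by (auto simp: ok_def)
  have "\<exists>f. \<forall>n. ok (f n) \<and> f n \<subseteq> f (Suc n) \<and> enum n (f n) \<subseteq> shed (f (Suc n))"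
  proof (rule dependent_nat_choice)
    show "\<exists>P'. ok P'"
      using absorb_finite[OF assms] by (simp add: ok_def)
  next
    fix P1 n assume ok: "ok P1"
    then have "finite (enum n P1)"
      by (auto simp: enum_def ok_def)
    then obtain P2 where "P1 \<subseteq> P2" "ntree r P2" "finite (tv r P2 - B)" "enum n P1 \<subseteq> shed P2"
      using absorb_finite[of "enum n P1" P1 B] ok ok_B[OF ok] by (auto simp: ok_def)
    then show "\<exists>P2. ok P2 \<and> P1 \<subseteq> P2 \<and> enum n P1 \<subseteq> shed P2"
      using ok shed_mono[of P1 P2] by (intro exI[of _ P2]) (auto simp: ok_def)
  qed
  then obtain f where f: "\<And>n. ok (f n)" "\<And>n. f n \<subseteq> f (Suc n)" "\<And>n. enum n (f n) \<subseteq> shed (f (Suc n))"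
    by blast
  have mono: "f m \<subseteq> f n" if "m \<le> n" for m n
    using lift_Suc_mono_le[of f, OF f(2) that] .
  let ?P = "\<Union>(range f)"
  have chain: "A \<subseteq> B \<or> B \<subseteq> A" if "A \<in> range f" "B \<in> range f" for A B
    using that mono by (metis imageE nat_le_linear)
  have nt: "\<And>A. A \<in> range f \<Longrightarrow> ntree r A"
    using f(1) by (auto simp: ok_def)
  then have tvP: "tv r ?P = (\<Union>n. tv r (f n))"
    by (auto simp: tv_def)
  have shed: "shed (f n) \<subseteq> shed ?P" for n
    by (rule shed_mono) blast
  have "F x \<subseteq> shed ?P" if x: "x \<in> tv r ?P" for x
  proof (cases "x \<in> B")
    case True
    then show ?thesis
      using ok_B[OF f(1), of x 0] shed[of 0] by blast
  next
    case False
    obtain m where m: "x \<in> tv r (f m)"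
      using x tvP by blast
    show ?thesis
    proof
      fix z assume "z \<in> F x"
      then obtain k where k: "from_nat_into (F x) k = z"
        using from_nat_into_surj[OF countable_F] by blast
      let ?n = "max m k"
      have "x \<in> tv r (f ?n)"
        using m tv_mono[OF mono[of m ?n]] by auto
      then have "z \<in> enum ?n (f ?n)"
        using False k max.cobounded2[of k m] unfolding enum_def by blast
      then show "z \<in> shed ?P"
        using f(3) shed by blast
    qed
  qed
  moreover have "ntree r ?P"
    using ntree_Union[OF _ nt chain] by blast
  moreover have "P \<subseteq> ?P" "Q \<subseteq> shed ?P"
    using f(1)[of 0] shed[of 0] by (auto simp: ok_def)
  ultimately show ?thesis
    by blast
qed

lemma ntree_empty: "ntree r {}"
  by (auto simp: ntree_def ptree_def tv_def comparable_def)

text \<open>In a maximal closed tree \<open>M\<close>, absorbing a root \<open>u\<close> changes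
  nothing, so \<open>u \<in> shed M\<close>; as \<open>{u}\<close> is itself rooted and connected,
  \<open>u\<close> must be in the tree.\<close>

lemma ex_spanning_ntree: "\<exists>P. ntree r P \<and> U \<subseteq> tv r P"
proof -
  define \<A> where "\<A> = {P. ntree r P \<and> (\<forall>x\<in>tv r P. F x \<subseteq> shed P)}"
  have "\<exists>M\<in>\<A>. \<forall>X\<in>\<A>. M \<subseteq> X \<longrightarrow> X = M"
  proof (rule subset_Zorn_nonempty)
    show "\<A> \<noteq> {}"
      using absorb_closed[of "{}" "{}" "{}"] ntree_empty by (auto simp: \<A>_def tv_def)
  next
    fix \<C> assume ne: "\<C> \<noteq> {}" and "subset.chain \<A> \<C>"
    then have \<C>: "\<C> \<subseteq> \<A>" and chain: "\<And>P Q. P \<in> \<C> \<Longrightarrow> Q \<in> \<C> \<Longrightarrow> P \<subseteq> Q \<or> Q \<subseteq> P"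
      by (auto simp: subset_chain_def)
    have nt: "\<And>P. P \<in> \<C> \<Longrightarrow> ntree r P"
      using \<C> by (auto simp: \<A>_def)
    have "F x \<subseteq> shed (\<Union>\<C>)" if x: "x \<in> tv r (\<Union>\<C>)" for x
    proof -
      obtain P where P: "P \<in> \<C>" "x \<in> tv r P"
        using x ne by (auto simp: tv_def)
      then have "F x \<subseteq> shed P"
        using \<C> by (auto simp: \<A>_def)
      then show ?thesis
        using shed_mono[of P "\<Union>\<C>"] P(1) by blast
    qed
    then show "\<Union>\<C> \<in> \<A>"
      using ntree_Union[OF ne nt chain] by (simp add: \<A>_def)
  qed
  then obtain M where M: "M \<in> \<A>" "\<And>X. X \<in> \<A> \<Longrightarrow> M \<subseteq> X \<Longrightarrow> X = M"
    by blast
  have "u \<in> tv r M" if u: "u \<in> U" for u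
  proof (rule ccontr)
    assume nu: "u \<notin> tv r M"
    have "\<exists>P'. M \<subseteq> P' \<and> ntree r P' \<and> (\<forall>x\<in>tv r P'. F x \<subseteq> shed P') \<and> {u} \<subseteq> shed P'"
      by (rule absorb_closed[of _ _ "tv r M"]) (use M(1) in \<open>auto simp: \<A>_def\<close>)
    then have "u \<in> shed M"
      using M(2) by (auto simp: \<A>_def)
    moreover have "rc {u}"
      using u U_subset by (auto simp: rc_def)
    ultimately show False
      using nu by (auto simp: shed_def)
  qed
  then show ?thesis
    using M(1) by (auto simp: \<A>_def)
qed

end

context rooted_minors
begin

lemma ex_ntree:
  assumes "r \<in> V"
  shows "\<exists>P. ntree r P \<and> U \<subseteq> tv r P"
proof -
  obtain F where F: "\<And>x. countable (F x)"
    "\<And>Y C. rc C \<Longrightarrow> (\<forall>y\<in>Y. F y \<inter> C = {}) \<Longrightarrow> finite (nb E Y C)"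
    using closure_operator by blast
  interpret tree_growth V E U r F
    by unfold_locales (use assms F in auto)
  show ?thesis
    by (rule ex_spanning_ntree)
qed

end

section \<open>Normal trees and the parent relation\<close>

text \<open>Two paths that diverge after their common first vertex meet again and close a
  cycle.\<close>

lemma path_unique:
  assumes acyc: "\<not> has_cycle E" and sym: "symp E"
    and "is_path E ps" "is_path E qs" "hd ps = hd qs" "last ps = last qs"
  shows "ps = qs"
  using assms(3-)
proof (induction ps arbitrary: qs)
  case Nil
  then show ?case
    by (simp add: is_path_def)
next
  case (Cons a ps)
  obtain qs' where qs: "qs = a # qs'"
    using Cons.prems by (cases qs) (auto simp: is_path_def)
  show ?case
  proof (cases "ps = [] \<or> qs' = []")
    case True
    then show ?thesis
      using Cons.prems qs last_in_set[of ps] last_in_set[of qs'] by (auto simp: is_path_successively split: if_splits)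
  next
    case False
    then have p: "is_path E ps" "is_path E qs'" "last ps = last qs'" "E a (hd ps)" "E a (hd qs')"
      "a \<notin> set ps" "a \<notin> set qs'"
      using Cons.prems qs by (auto simp: is_path_successively successively_Cons)
    have "hd ps = hd qs'"
    proof (rule ccontr)
      assume neq: "hd ps \<noteq> hd qs'"
      have "\<exists>x\<in>set ps. x \<in> set qs'"
        using False p(3) last_in_set by metis
      \<comment> \<open>\<open>z\<close> is the first vertex of one path on the other. The cycle
        runs from \<open>a\<close> along \<open>us\<close> to \<open>z\<close> and back along
        \<open>xs\<close>; it has at least three vertices because \<open>us\<close> and
        \<open>xs\<close> are not both empty.\<close>
      then obtain us z vs where us: "ps = us @ z # vs" "z \<in> set qs'" "\<And>u. u \<in> set us \<Longrightarrow> u \<notin> set qs'"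
        using split_list_first_prop[of ps "\<lambda>x. x \<in> set qs'"] by blast
      obtain xs ys where xs: "qs' = xs @ z # ys"
        using us(2) by (meson split_list)
      let ?c = "(a # us) @ z # rev xs"
      have "successively E ((a # us) @ z # vs)"
        using Cons.prems(1) us(1) by (simp add: is_path_successively)
      then have "successively E ((a # us) @ [z])"
        unfolding successively_append_iff[of E "a # us"] by simp
      moreover have "successively E (xs @ [z])"
        using p(2) xs by (auto simp: is_path_successively successively_append_iff)
      then have "successively (\<lambda>x y. E y x) (xs @ [z])"
        using sym by (auto elim!: successively_mono dest: sympD)
      then have "successively E (rev (xs @ [z]))"
        by (simp only: successively_rev)
      then have "successively E (z # rev xs)"
        by simp
      ultimately have "successively E ?c"
        unfolding successively_append_iff[of E "a # us"] by simp
      moreover have "distinct ?c"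
        using p us xs by (auto simp: is_path_successively)
      ultimately have "is_path E ?c"
        by (simp add: is_path_successively)
      moreover have "3 \<le> length ?c"
        using neq us(1) xs by (cases us; cases xs) auto
      moreover have "last ?c = hd qs'"
        using xs by (cases xs) auto
      then have "E (last ?c) (hd ?c)"
        using p(5) sym by (auto dest: sympD)
      ultimately show False
        using acyc unfolding has_cycle_def by blast
    qed
    then show ?thesis
      using Cons.IH[OF p(1,2) _ p(3)] qs by simp
  qed
qed

lemma conn_path:
  assumes "symp E" "successively E ps"
  shows "conn E (set ps)"
  using assms(2)
proof (induction ps rule: induct_list012)
  case (3 x y zs)
  then have "conn E (set (y # zs))" "E x y"
    by auto
  then have "conn E ({x} \<union> set (y # zs))"
    using conn_Un[OF assms(1) conn_singleton, of "set (y # zs)" x x y] by auto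
  moreover have "set (x # y # zs) = {x} \<union> set (y # zs)"
    by auto
  ultimately show ?case
    by metis
qed (auto simp: conn_def)

definition tree_edge :: "('a \<times> 'a) set \<Rightarrow> 'a \<Rightarrow> 'a \<Rightarrow> bool" where
  "tree_edge P x y \<longleftrightarrow> (x, y) \<in> P \<or> (y, x) \<in> P"

lemma ptree_path:
  assumes P: "ptree r P" and "y \<in> tv r P"
  shows "\<exists>ps. is_path (tree_edge P) ps \<and> hd ps = r \<and> last ps = y \<and> set ps = {x. (y, x) \<in> P\<^sup>*}"
proof -
  have "(y, r) \<in> P\<^sup>*"
    using assms by (auto simp: ptree_def)
  then show ?thesis
  proof (induction rule: converse_rtrancl_induct)
    case base
    have "{x. (r, x) \<in> P\<^sup>*} = {r}"
      using P by (auto simp: ptree_def elim: converse_rtranclE)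
    then show ?case
      by (intro exI[of _ "[r]"]) (auto simp: is_path_def)
  next
    case (step y z)
    then obtain ps where ps: "is_path (tree_edge P) ps" "hd ps = r" "last ps = z" "set ps = {x. (z, x) \<in> P\<^sup>*}"
      by blast
    have "(y, x) \<in> P\<^sup>* \<longleftrightarrow> x = y \<or> (z, x) \<in> P\<^sup>*" for x
    proof
      assume "(y, x) \<in> P\<^sup>*"
      then show "x = y \<or> (z, x) \<in> P\<^sup>*"
        using step.hyps(1) P by (cases rule: converse_rtranclE) (auto simp: ptree_def single_valued_def)
    qed (use step.hyps(1) in \<open>auto intro: converse_rtrancl_into_rtrancl\<close>)
    then have "{x. (y, x) \<in> P\<^sup>*} = insert y {x. (z, x) \<in> P\<^sup>*}"
      by auto
    moreover have "(z, y) \<notin> P\<^sup>*"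
      using ptree_acyclic[OF P] step.hyps(1) by (meson rtrancl_into_trancl2)
    ultimately show ?case
      using ps step.hyps(1)
      by (intro exI[of _ "ps @ [y]"]) (auto simp: is_path_successively successively_append_iff tree_edge_def)
  qed
qed

lemma ptree_is_tree:
  assumes P: "ptree r P"
  shows "is_tree (tv r P) (tree_edge P)"
proof -
  let ?T = "tv r P" and ?E = "tree_edge P"
  have mem: "x \<in> ?T \<and> y \<in> ?T" if "(x, y) \<in> P" for x y
    using that ptree_tree_order_closed[OF P, of x y] by (auto simp: tv_def)
  have irr: "(x, x) \<notin> P" for x
    using ptree_acyclic[OF P, of x] by auto
  have g: "graph ?T ?E"
    using mem irr by (auto simp: graph_def tree_edge_def)
  have symp: "symp ?E"
    by (auto simp: symp_def tree_edge_def)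
  have "connected_graph ?T ?E"
    unfolding connected_graph_def
  proof (intro conjI ballI)
    fix x y assume xy: "x \<in> ?T" "y \<in> ?T"
    have "P \<subseteq> edges_in ?E ?T"
      using mem by (auto simp: edges_in_def tree_edge_def)
    then have to_r: "(z, r) \<in> (edges_in ?E ?T)\<^sup>*" if "z \<in> ?T" for z
      using that P rtrancl_mono[of P "edges_in ?E ?T"] by (auto simp: ptree_def)
    then have "(x, y) \<in> (edges_in ?E ?T)\<^sup>*"
      using xy edges_in_rtrancl_sym[OF symp to_r[OF xy(2)]] by (meson rtrancl_trans)
    then show "\<exists>ps. is_path ?E ps \<and> hd ps = x \<and> last ps = y"
      using rtrancl_edges_in_path xy(1) by metis
  qed (simp add: tv_def)
  \<comment> \<open>A vertex of maximal height on a cycle would have both its neighbours on the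
    cycle as parents.\<close>
  moreover have "\<not> has_cycle ?E"
  proof
    assume "has_cycle ?E"
    then obtain ps where ps: "is_path ?E ps" "3 \<le> length ps" "?E (last ps) (hd ps)"
      by (auto simp: has_cycle_def)
    let ?n = "length ps"
    have ne: "ps \<noteq> []"
      using ps(2) by auto
    have cyc: "?E (ps ! i) (ps ! (Suc i mod ?n))" if "i < ?n" for i
    proof (cases "Suc i < ?n")
      case True
      then show ?thesis
        using ps(1) by (simp add: is_path_def)
    next
      case False
      then have "i = ?n - 1" "Suc i = ?n"
        using that by simp_all
      then have "ps ! i = last ps" "ps ! (Suc i mod ?n) = hd ps"
        using ne by (auto simp: last_conv_nth hd_conv_nth)
      then show ?thesis
        using ps(3) by simp
    qed
    have "Max (ht P ` set ps) \<in> ht P ` set ps"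
      using ne by (intro Max_in) auto
    then obtain i where i: "i < ?n" "ht P (ps ! i) = Max (ht P ` set ps)"
      by (auto simp: in_set_conv_nth)
    have max: "ht P (ps ! j) \<le> ht P (ps ! i)" if "j < ?n" for j
      using that i(2) by auto
    have down: "(ps ! i, ps ! j) \<in> P" if j: "j < ?n" "?E (ps ! i) (ps ! j)" for j
    proof (rule ccontr)
      assume "(ps ! i, ps ! j) \<notin> P"
      then have "(ps ! j, ps ! i) \<in> P"
        using j(2) by (simp add: tree_edge_def)
      then have "ht P (ps ! i) < ht P (ps ! j)"
        using mem[of "ps ! j" "ps ! i"] irr[of "ps ! i"] by (intro ptree_ht_less[OF P]) auto
      then show False
        using max[OF j(1)] by simp
    qed
    define j where "j = Suc i mod ?n"
    \<comment> \<open>The cyclic predecessor of \<open>i\<close>; it differs from the successor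
      \<open>j\<close> because the cycle has length at least three.\<close>
    define k where "k = (if i = 0 then ?n - 1 else i - 1)"
    have jk: "j < ?n" "k < ?n" "Suc k mod ?n = i" "j \<noteq> k"
      using i(1) ps(2) by (auto simp: j_def k_def mod_Suc)
    have "(ps ! i, ps ! j) \<in> P"
      using down[OF jk(1)] cyc[OF i(1)] by (simp add: j_def)
    moreover have "(ps ! i, ps ! k) \<in> P"
      using down[OF jk(2)] cyc[OF jk(2)] jk(3) symp by (simp add: sympD)
    ultimately have "ps ! j = ps ! k"
      using P by (auto simp: ptree_def single_valued_def)
    then show False
      using jk ps(1) by (simp add: is_path_def nth_eq_iff_index_eq)
  qed
  ultimately show ?thesis
    using g by (simp add: is_tree_def)
qed

section \<open>Translation between normal trees and parent relations\<close>

context rooted_graph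
begin

lemma conn_subset_V:
  assumes "conn E C" "a \<in> C" "a \<in> V"
  shows "C \<subseteq> V"
proof
  fix b assume "b \<in> C"
  then have "(a, b) \<in> (edges_in E C)\<^sup>*"
    using assms(1,2) by (auto simp: conn_def)
  then show "b \<in> V"
    using assms(3) E_in_V by (cases rule: rtranclE) (auto simp: edges_in_def)
qed

lemma T_path_linked:
  assumes "T_path T ET E ps"
  shows "linked T (hd ps) (last ps)"
proof -
  have ps: "is_path E ps" "2 \<le> length ps" "\<And>i. 0 < i \<Longrightarrow> i < length ps - 1 \<Longrightarrow> ps ! i \<notin> T"
    using assms by (auto simp: T_path_def)
  obtain x ps' where "ps = x # ps'" "ps' \<noteq> []"
    using ps(2) by (cases ps) (auto simp: Suc_le_eq)
  then obtain qs y where qs: "ps = x # qs @ [y]"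
    by (metis append_butlast_last_id)
  show ?thesis
  proof (cases "qs = []")
    case True
    then show ?thesis
      using ps(1) qs by (auto simp: is_path_successively linked_def)
  next
    case False
    then have s: "successively E qs" "E x (hd qs)" "E (last qs) y"
      using ps(1) qs by (auto simp: is_path_successively successively_Cons successively_append_iff)
    have c: "conn E (set qs)"
      using conn_path[OF symp_E s(1)] .
    moreover have "set qs \<subseteq> V"
      using conn_subset_V[OF c] False s(2) E_in_V by (meson hd_in_set)
    moreover have "q \<notin> T" if "q \<in> set qs" for q
    proof -
      obtain i where i: "i < length qs" "q = qs ! i"
        using \<open>q \<in> set qs\<close> by (auto simp: in_set_conv_nth)
      then show ?thesis
        using ps(3)[of "Suc i"] qs by (simp add: nth_append)
    qed
    moreover have "E (hd qs) x" "hd qs \<in> set qs" "last qs \<in> set qs"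
      using s(2) E_sym False by auto
    ultimately show ?thesis
      using s(3) qs unfolding linked_def by auto
  qed
qed

lemma ntree_normal_tree:
  assumes P: "ntree r P" and "r \<in> V"
  shows "normal_tree V E (tv r P) (tree_edge P) r"
proof -
  have pt: "ptree r P"
    using P by (simp add: ntree_def)
  have le: "tree_le (tree_edge P) r x y" if "(y, x) \<in> P\<^sup>*" "y \<in> tv r P" for x y
    using ptree_path[OF pt that(2)] that(1) unfolding tree_le_def by blast
  have "subgraph (tv r P) (tree_edge P) V E"
    using ntree_tv_subset_V[OF assms] P E_sym by (auto simp: subgraph_def tree_edge_def ntree_def)
  moreover have "tree_le (tree_edge P) r (hd ps) (last ps) \<or> tree_le (tree_edge P) r (last ps) (hd ps)"
    if ps: "T_path (tv r P) (tree_edge P) E ps" for ps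
  proof -
    have "hd ps \<in> tv r P" "last ps \<in> tv r P"
      using ps by (auto simp: T_path_def)
    moreover from this have "comparable P (hd ps) (last ps)"
      using P T_path_linked[OF ps] by (auto simp: ntree_def)
    ultimately show ?thesis
      using le by (auto simp: comparable_def)
  qed
  ultimately show ?thesis
    using ptree_is_tree[OF pt] by (auto simp: normal_tree_def tv_def)
qed

lemma T_path_through:
  assumes sub: "\<And>x y. ET x y \<Longrightarrow> x \<in> T \<and> y \<in> T"
    and xy: "x \<in> T" "y \<in> T" "x \<noteq> y"
    and C: "conn E C" "C \<inter> T = {}" "a \<in> C" "E a x" "b \<in> C" "E b y"
  shows "\<exists>ps. T_path T ET E ps \<and> hd ps = x \<and> last ps = y"
proof -
  have "(a, b) \<in> (edges_in E C)\<^sup>*"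
    using C by (auto simp: conn_def)
  then obtain qs where qs: "is_path E qs" "set qs \<subseteq> C" "hd qs = a" "last qs = b"
    using rtrancl_edges_in_path C(3) by metis
  let ?ps = "x # qs @ [y]"
  have ne: "qs \<noteq> []"
    using qs(1) by (simp add: is_path_def)
  have path: "is_path E ?ps"
    using qs C xy E_sym[OF C(4)] ne
    by (auto simp: is_path_successively successively_Cons successively_append_iff)
  have inner: "?ps ! i \<notin> T" if i: "0 < i" "i < length ?ps - 1" for i
  proof -
    obtain j where j: "i = Suc j"
      using i(1) gr0_implies_Suc by blast
    then have "?ps ! i = qs ! j" "j < length qs"
      using i(2) by (auto simp: nth_append)
    moreover from this have "qs ! j \<in> C"
      using qs(2) by (meson nth_mem subsetD)
    ultimately show ?thesis
      using C(2) by (metis IntI empty_iff)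
  qed
  have "\<not> ET (?ps ! i) (?ps ! Suc i)" if i: "Suc i < length ?ps" for i
  proof (cases "i = 0")
    case True
    then show ?thesis
      using inner[of 1] sub ne by (cases qs) auto
  next
    case False
    then show ?thesis
      using inner[of i] sub i by auto
  qed
  then show ?thesis
    using path inner xy by (intro exI[of _ ?ps]) (auto simp: T_path_def)
qed

lemma normal_tree_ntree:
  assumes nt: "normal_tree V E T ET r"
  shows "\<exists>P. ntree r P \<and> tv r P = T"
proof -
  have sub: "\<And>x y. ET x y \<Longrightarrow> E x y" and g: "graph T ET" and conn: "connected_graph T ET"
    and acyc: "\<not> has_cycle ET" and r: "r \<in> T"
    and norm: "\<And>ps. T_path T ET E ps \<Longrightarrow> tree_le ET r (hd ps) (last ps) \<or> tree_le ET r (last ps) (hd ps)"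
    using nt by (auto simp: normal_tree_def subgraph_def is_tree_def)
  have symp: "symp ET" and ET_T: "\<And>x y. ET x y \<Longrightarrow> x \<in> T \<and> y \<in> T"
    using g by (auto simp: graph_def symp_def)
  have uniq: "ps = qs" if "is_path ET ps" "is_path ET qs" "hd ps = hd qs" "last ps = last qs" for ps qs
    using path_unique[OF acyc symp] that by blast
  \<comment> \<open>The parent of \<open>y\<close> is its predecessor on the path from
    \<open>r\<close> to \<open>y\<close>, which is unique since the tree has no cycle.\<close>
  define P where "P = {(y, x). \<exists>ps. is_path ET (ps @ [x, y]) \<and> hd (ps @ [x, y]) = r}"
  have up: "(y, x) \<in> P\<^sup>*" if "is_path ET ps" "hd ps = r" "last ps = y" "x \<in> set ps" for ps x y
    using that
  proof (induction ps arbitrary: y rule: rev_induct)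
    case (snoc z ps)
    show ?case
    proof (cases "ps = [] \<or> x = y")
      case False
      then obtain ps' w where w: "ps = ps' @ [w]"
        by (metis append_butlast_last_id)
      have "is_path ET ps"
        using snoc.prems(1) w by (auto simp: is_path_successively successively_append_iff)
      then have "(w, x) \<in> P\<^sup>*"
        using snoc w False by (auto simp: hd_append)
      moreover have "(y, w) \<in> P"
        using snoc.prems w by (auto simp: P_def intro!: exI[of _ ps'])
      ultimately show ?thesis
        by (meson converse_rtrancl_into_rtrancl)
    qed (use snoc.prems in auto)
  qed (simp add: is_path_def)
  have ex: "\<exists>ps. is_path ET ps \<and> hd ps = r \<and> last ps = y" if "y \<in> T" for y
    using conn r that by (auto simp: connected_graph_def)
  have edge: "ET x y" if yx: "(y, x) \<in> P" for x y
    using yx by (auto simp: P_def is_path_successively successively_append_iff)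
  have tv: "tv r P = T"
  proof
    show "tv r P \<subseteq> T"
      using edge ET_T r by (auto simp: tv_def)
    show "T \<subseteq> tv r P"
    proof
      fix y assume "y \<in> T"
      then obtain ps where ps: "is_path ET ps" "hd ps = r" "last ps = y"
        using ex by blast
      then have "(y, r) \<in> P\<^sup>*"
        using up[of ps y r] hd_in_set[of ps] by (auto simp: is_path_def)
      then show "y \<in> tv r P"
        by (auto simp: tv_def elim: converse_rtranclE)
    qed
  qed
  have "single_valued P"
    unfolding single_valued_def
  proof (intro allI impI)
    fix y x x' assume "(y, x) \<in> P" "(y, x') \<in> P"
    then obtain ps ps' where ps: "is_path ET (ps @ [x, y])" "hd (ps @ [x, y]) = r"
      "is_path ET (ps' @ [x', y])" "hd (ps' @ [x', y]) = r"
      by (auto simp: P_def)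
    have "ps @ [x, y] = ps' @ [x', y]"
      by (rule uniq) (use ps in auto)
    then show "x = x'"
      by simp
  qed
  moreover have "r \<notin> Domain P"
  proof
    assume "r \<in> Domain P"
    then obtain x ps where ps: "is_path ET (ps @ [x, r])" "hd (ps @ [x, r]) = r"
      by (auto simp: P_def)
    have "ps @ [x, r] = [r]"
      by (rule uniq) (use ps in \<open>auto simp: is_path_def\<close>)
    then show False
      by simp
  qed
  moreover have "(y, r) \<in> P\<^sup>*" if "y \<in> T" for y
  proof -
    obtain ps where "is_path ET ps" "hd ps = r" "last ps = y"
      using ex \<open>y \<in> T\<close> by blast
    then show ?thesis
      using up[of ps y r] hd_in_set[of ps] by (auto simp: is_path_def)
  qed
  ultimately have pt: "ptree r P"
    using tv by (simp add: ptree_def)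
  have le: "(y, x) \<in> P\<^sup>*" if "tree_le ET r x y" for x y
    using that up unfolding tree_le_def by blast
  \<comment> \<open>An edge between \<open>x\<close> and \<open>y\<close> is a \<open>T\<close>-path
    only outside the tree, and \<open>T_path_through\<close> needs distinct ends; equal or
    tree-adjacent vertices are therefore treated apart.\<close>
  have "comparable P x y" if xy: "x \<in> T" "y \<in> T" "linked T x y" for x y
  proof (cases "x = y \<or> ET x y")
    case True
    then show ?thesis
    proof
      assume ET: "ET x y"
      obtain ps where ps: "is_path ET ps" "hd ps = r" "last ps = x"
        using ex[OF xy(1)] by blast
      show ?thesis
      proof (cases "y \<in> set ps")
        case True
        then show ?thesis
          using up[OF ps] by (simp add: comparable_def)
      next
        case False
        have ne: "ps \<noteq> []"
          using ps(1) by (simp add: is_path_def)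
        have "is_path ET (ps @ [y])"
          using ps ET False by (auto simp: is_path_successively successively_append_iff)
        then have "(y, x) \<in> P\<^sup>*"
          using up[of "ps @ [y]" y x] ps ne by (auto simp: hd_append)
        then show ?thesis
          by (simp add: comparable_def)
      qed
    qed (simp add: comparable_def)
  next
    case False
    have "\<exists>ps. T_path T ET E ps \<and> hd ps = x \<and> last ps = y"
      using xy(3) unfolding linked_def
    proof (elim disjE exE conjE bexE)
      assume "E x y"
      then show ?thesis
        using xy False by (intro exI[of _ "[x, y]"]) (auto simp: T_path_def is_path_def)
    next
      fix C a b assume "conn E C" "C \<inter> T = {}" "a \<in> C" "E a x" "b \<in> C" "E b y"
      then show ?thesis
        using T_path_through[OF ET_T] xy(1,2) False by blast
    qed
    then show ?thesis
      using norm le unfolding comparable_def by blast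
  qed
  then have "ntree r P"
    using pt tv edge sub E_sym by (auto simp: ntree_def)
  then show ?thesis
    using tv by blast
qed

text \<open>On a walk in \<open>Z\<close> from \<open>t\<close>, all visits to the tree stay above
  \<open>t\<close>. Consecutive visits are linked, hence comparable; if the later one lies below the
  earlier, it is on the same chain of parents as \<open>t\<close>, and minimality of the height of
  \<open>t\<close> decides.\<close>

lemma ntree_least_of_conn:
  assumes P: "ntree r P" and Z: "conn E Z" "Z \<subseteq> V" and t: "t \<in> Z" "t \<in> tv r P"
    and least: "\<And>z. z \<in> Z \<Longrightarrow> z \<in> tv r P \<Longrightarrow> ht P t \<le> ht P z" and z: "z \<in> Z" "z \<in> tv r P"
  shows "(z, t) \<in> P\<^sup>*"
proof -
  let ?T = "tv r P"
  have pt: "ptree r P"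
    using P by (simp add: ntree_def)
  have key: "(w, t) \<in> P\<^sup>*" if w: "w \<in> Z" "w \<in> ?T" "y \<in> ?T" "(y, t) \<in> P\<^sup>*" "linked ?T y w" for y w
  proof -
    have "comparable P y w"
      using P w by (auto simp: ntree_def)
    then consider "(w, y) \<in> P\<^sup>*" | "(y, w) \<in> P\<^sup>*"
      by (auto simp: comparable_def)
    then show ?thesis
    proof cases
      case 2
      then have "(w, t) \<in> P\<^sup>* \<or> (t, w) \<in> P\<^sup>*"
        using single_valued_confluent[OF _ 2 w(4)] pt by (simp add: ptree_def)
      then show ?thesis
        using ptree_ht_less[OF pt t(2), of w] least[OF w(1,2)] by fastforce
    qed (use w(4) in \<open>meson rtrancl_trans\<close>)
  qed
  \<comment> \<open>For \<open>w\<close> off the tree the invariant remembers the connected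
    excursion \<open>C\<close> around \<open>w\<close> and a tree vertex \<open>y\<close> above
    \<open>t\<close> to which \<open>C\<close> is attached.\<close>
  define J where "J w \<longleftrightarrow> (if w \<in> ?T then (w, t) \<in> P\<^sup>* else \<exists>C y. conn E C \<and> C \<subseteq> Z \<and> C \<inter> ?T = {} \<and> w \<in> C \<and>
    (\<exists>c\<in>C. E c y) \<and> y \<in> ?T \<and> (y, t) \<in> P\<^sup>*)" for w
  have "(t, z) \<in> (edges_in E Z)\<^sup>*"
    using Z(1) t(1) z(1) by (auto simp: conn_def)
  then have "J z"
  proof (induction rule: rtrancl_induct)
    case base
    then show ?case
      using t by (simp add: J_def)
  next
    case (step w v)
    have wv: "E w v" "w \<in> Z" "v \<in> Z"
      using step.hyps by (auto simp: edges_in_def)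
    show ?case
    proof (cases "w \<in> ?T")
      case wT: True
      then have wt: "(w, t) \<in> P\<^sup>*"
        using step.IH by (simp add: J_def)
      show ?thesis
      proof (cases "v \<in> ?T")
        case True
        then show ?thesis
          using key[of v w] wv wT wt by (auto simp: J_def linked_def)
      next
        case False
        then show ?thesis
          using wv wT wt E_sym by (auto simp: J_def intro!: exI[of _ "{v}"] exI[of _ w])
      qed
    next
      case False
      then obtain C y c where C: "conn E C" "C \<subseteq> Z" "C \<inter> ?T = {}" "w \<in> C" "c \<in> C" "E c y" "y \<in> ?T" "(y, t) \<in> P\<^sup>*"
        using step.IH by (auto simp: J_def)
      show ?thesis
      proof (cases "v \<in> ?T")
        case True
        have "linked ?T y v"
          using C wv Z(2) unfolding linked_def by blast
        then show ?thesis
          using key[of v y] True wv C by (auto simp: J_def)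
      next
        case False
        have "conn E (C \<union> {v})"
          using conn_Un[OF symp_E C(1) conn_singleton C(4)] wv(1) by blast
        then show ?thesis
          using C False wv(3) unfolding J_def by (auto intro!: exI[of _ "C \<union> {v}"] exI[of _ y])
      qed
    qed
  qed
  then show ?thesis
    using z(2) by (simp add: J_def)
qed

end

section \<open>Colouring numbers of minors rooted in a normal tree\<close>

lemma well_order_on_lex_nat:
  assumes W: "well_order_on A W"
  shows "well_order_on A {(x, y) \<in> A \<times> A. g x < (g y :: nat) \<or> g x = g y \<and> (x, y) \<in> W}" (is "well_order_on A ?R")
proof -
  have W': "refl_on A W" "trans W" "antisym W" "total_on A W" "wf (W - Id)"
    using W by (auto simp: well_order_on_def linear_order_on_def partial_order_on_def preorder_on_def)
  have "refl_on A ?R"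
    using W'(1) by (auto simp: refl_on_def)
  moreover have "trans ?R"
    using W'(2) unfolding trans_def by (auto; force)
  moreover have "antisym ?R"
    using W'(3) unfolding antisym_def by auto
  moreover have "total_on A ?R"
    using W'(4) unfolding total_on_def by auto
  moreover have "wf (?R - Id)"
  proof (rule wf_subset)
    show "wf (inv_image (less_than <*lex*> (W - Id)) (\<lambda>x. (g x, x)))"
      using W'(5) by (intro wf_inv_image wf_lex_prod wf_less_than)
    show "?R - Id \<subseteq> inv_image (less_than <*lex*> (W - Id)) (\<lambda>x. (g x, x))"
      by auto
  qed
  ultimately show ?thesis
    by (auto simp: well_order_on_def linear_order_on_def partial_order_on_def preorder_on_def)
qed

context rooted_graph
begin

lemma rooted_minor_countable_colouring_number:
  assumes P: "ntree r P" and UT: "U \<subseteq> tv r P"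
    and minor: "is_minor V E VH EH" and rooted: "rooted_minor U VH"
  shows "countable_colouring_number VH EH"
proof -
  let ?T = "tv r P"
  have g: "graph VH EH" and branch: "\<And>X. X \<in> VH \<Longrightarrow> X \<subseteq> V \<and> conn E X"
    and disj: "\<And>X Y. X \<in> VH \<Longrightarrow> Y \<in> VH \<Longrightarrow> X \<noteq> Y \<Longrightarrow> X \<inter> Y = {}"
    and edge: "\<And>X Y. EH X Y \<Longrightarrow> \<exists>x\<in>X. \<exists>y\<in>Y. E x y"
    using minor by (auto simp: is_minor_def connected_set_iff_conn)
  have "\<exists>t. t \<in> X \<inter> ?T \<and> (\<forall>z. z \<in> X \<inter> ?T \<longrightarrow> ht P t \<le> ht P z)" if X: "X \<in> VH" for X
  proof -
    obtain u where "u \<in> X \<inter> ?T"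
      using rooted UT X unfolding rooted_minor_def by blast
    then show ?thesis
      using ex_has_least_nat[of "\<lambda>t. t \<in> X \<inter> ?T" u "ht P"] by blast
  qed
  then obtain t where t: "\<And>X. X \<in> VH \<Longrightarrow> t X \<in> X \<inter> ?T"
    and least: "\<And>X z. X \<in> VH \<Longrightarrow> z \<in> X \<inter> ?T \<Longrightarrow> ht P (t X) \<le> ht P z"
    by metis
  have below: "(t Y, t X) \<in> P\<^sup>*" if XY: "EH X Y" "ht P (t X) \<le> ht P (t Y)" for X Y
  proof -
    have VH: "X \<in> VH" "Y \<in> VH"
      using g XY(1) by (auto simp: graph_def)
    obtain x y where "x \<in> X" "y \<in> Y" "E x y"
      using edge[OF XY(1)] by blast
    then have "conn E (X \<union> Y)"
      using conn_Un[OF symp_E] branch VH by blast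
    moreover have "ht P (t X) \<le> ht P z" if z: "z \<in> X \<union> Y" "z \<in> ?T" for z
      using z least[OF VH(1), of z] least[OF VH(2), of z] XY(2) by fastforce
    ultimately show ?thesis
      using ntree_least_of_conn[OF P, of "X \<union> Y" "t X" "t Y"] branch VH t by blast
  qed
  obtain W where W: "well_order_on VH W"
    using well_order_on by blast
  \<comment> \<open>Ties in height are broken by an arbitrary well-order, which is harmless since
    \<open>below\<close> also covers equal heights.\<close>
  define R where "R = {(X, Y) \<in> VH \<times> VH. ht P (t X) < ht P (t Y) \<or> ht P (t X) = ht P (t Y) \<and> (X, Y) \<in> W}"
  have "well_order_on VH R"
    unfolding R_def using well_order_on_lex_nat[OF W] .
  then have "Well_order R" "Field R = VH"
    using well_order_on_Field by blast+
  moreover have "finite {Y. EH X Y \<and> (Y, X) \<in> R \<and> Y \<noteq> X}" if X: "X \<in> VH" for X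
  proof (rule inj_on_finite[of t _ "{z. (t X, z) \<in> P\<^sup>*}"])
    have "Y = Y'" if "Y \<in> VH" "Y' \<in> VH" "t Y = t Y'" for Y Y'
      using disj[of Y Y'] t[of Y] t[of Y'] that by auto
    then show "inj_on t {Y. EH X Y \<and> (Y, X) \<in> R \<and> Y \<noteq> X}"
      by (auto simp: inj_on_def R_def)
    show "t ` {Y. EH X Y \<and> (Y, X) \<in> R \<and> Y \<noteq> X} \<subseteq> {z. (t X, z) \<in> P\<^sup>*}"
    proof clarify
      fix Y assume Y: "EH X Y" "(Y, X) \<in> R"
      then have "EH Y X" "ht P (t Y) \<le> ht P (t X)"
        using g by (auto simp: graph_def R_def)
      then show "(t X, t Y) \<in> P\<^sup>*"
        using below by blast
    qed
    show "finite {z. (t X, z) \<in> P\<^sup>*}"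
      using ptree_finite_down[of r P "t X"] P t[OF X] by (simp add: ntree_def)
  qed
  ultimately show ?thesis
    unfolding countable_colouring_number_def by blast
qed

end

theorem theorem1p2:
  fixes V :: "'a set" and E :: "'a \<Rightarrow> 'a \<Rightarrow> bool" and U :: "'a set"
  assumes "graph V E" and "connected_graph V E" and "U \<subseteq> V"
  shows "normally_spanned V E U \<longleftrightarrow>
    (\<forall>VH EH. is_minor V E VH EH \<and> rooted_minor U VH \<longrightarrow> countable_colouring_number VH EH)"
proof -
  interpret rooted_graph V E U
    using assms connected_graph_imp_conn by unfold_locales
  show ?thesis
  proof
    assume "normally_spanned V E U"
    then obtain T ET r where "normal_tree V E T ET r" "U \<subseteq> T"
      by (auto simp: normally_spanned_def)
    then obtain P where "ntree r P" "U \<subseteq> tv r P"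
      using normal_tree_ntree by blast
    then show "\<forall>VH EH. is_minor V E VH EH \<and> rooted_minor U VH \<longrightarrow> countable_colouring_number VH EH"
      using rooted_minor_countable_colouring_number by blast
  next
    assume "\<forall>VH EH. is_minor V E VH EH \<and> rooted_minor U VH \<longrightarrow> countable_colouring_number VH EH"
    then interpret rooted_minors V E U
      by unfold_locales blast
    obtain r where r: "r \<in> V"
      using assms(2) by (auto simp: connected_graph_def)
    obtain P where "ntree r P" "U \<subseteq> tv r P"
      using ex_ntree[OF r] by blast
    then show "normally_spanned V E U"
      using ntree_normal_tree[OF _ r] unfolding normally_spanned_def by blast
  qed
qed

end
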